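(* Let $K\ge 2$ and suppose that the prior densities $\pi$ and $\varrho$ on $\Delta$ both satisfy Condition $\mathcal P$ (possibly with different exponent vectors). Let $\bar k\in\{1,\dots,K\}$, $c\in(0,\infty)$, and $\epsilon,\delta\in(0,1)$. Suppose that in every period the die to be tossed is chosen at random, independently of the past, and that \[ \liminf_{n\to\infty}\frac{\mathbb E(B_n)}{n}>0,\qquad \limsup_{n\to\infty}\frac{\mathbb E(B_n)}{n}<1. \] Then there exists $N\in\mathbb N$ such that \[ \mathbb P_\vartheta\bigl(\hat p_{\bar k}(X^n)\ge c(1-\delta)\,\hat q_{\bar k}(X^n)\bigr)\ge 1-\epsilon \] for all $\vartheta=(p,q)\in\Delta^2$ with $p_{\bar k}\ge c\,q_{\bar k}$ and all $n\in\mathbb N$ with $n p_{\bar k}\ge N$.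
   Context: $\mathbb N$ is the set of positive integers. $\Delta=\{p\in[0,1]^K: p_1+\dots+p_K=1\}$, $\operatorname{int}\Delta$ is its (relative) interior, i.e. the points with all coordinates positive, and $\lambda$ is the Lebesgue measure on $\Delta$ normalized by $\lambda(\Delta)=1/(K-1)!$. A density on $\Delta$ means a probability density with respect to $\lambda$. Condition $\mathcal P$: a density $\pi$ on $\Delta$ satisfies Condition $\mathcal P(\alpha)$, where $\alpha=(\alpha_1,\dots,\alpha_K)\in(0,\infty)^K$, if $\pi(p)/\prod_{k=1}^K p_k^{\alpha_k-1}$ is uniformly continuous and bounded away from zero on $\operatorname{int}\Delta$; $\pi$ satisfies Condition $\mathcal P$ if it satisfies $\mathcal P(\alpha)$ for some $\alpha\in(0,\infty)^K$. Setting: there are two $K$-sided dice, blue and red. In each period $1,2,\dots$ one die is chosen at random, independently of the past (past choices and past outcomes), and tossed. The probability of choosing the blue die need not be constant over time but does not depend on the unknown parameter $\vartheta$. The blue die lands on side $k$ with probability $p_k$, the red die with probability $q_k$, independently of past outcomes; the parameter is $\vartheta=(p,q)\in\Delta^2$ and $\mathbb P_\vartheta$ is the probability under $\vartheta$. $X^n$ denotes the (observed) colors and sides of the first $n$ tosses, and the random variable $B_n$ is the number of times the blue die is tossed in the first $n$ periods. The observer's prior on $\Delta^2$ has the product density $\pi(p)\varrho(q)$. The Bayes estimators are the posterior means: if $y_i$ (resp. $z_i$) is the number of times the blue (resp. red) die lands on side $i$ in the first $n$ periods, then \[ \hat p_k(X^n)=\frac{\int p_k\prod_{i=1}^K p_i^{y_i}\,\pi(p)\,d\lambda(p)}{\int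 \prod_{i=1}^K p_i^{y_i}\,\pi(p)\,d\lambda(p)},\qquad \hat q_k(X^n)=\frac{\int q_k\prod_{i=1}^K q_i^{z_i}\,\varrho(q)\,d\lambda(q)}{\int \prod_{i=1}^K q_i^{z_i}\,\varrho(q)\,d\lambda(q)}. \] *)

theory Defs
  imports "HOL-Probability.Probability"
begin

section \<open>The simplex and its Lebesgue measure\<close>

definition prob_simplex :: "(real ^ 'k::finite) set" where
  "prob_simplex = {p. (\<forall>k. 0 \<le> p $ k) \<and> (\<Sum>k\<in>UNIV. p $ k) = 1}"

definition simplex_interior :: "(real ^ 'k::finite) set" where
  "simplex_interior = {p \<in> prob_simplex. \<forall>k. 0 < p $ k}"

text \<open>
  \<open>chart j\<close> parametrizes the hyperplane of points with coordinate sum 1 by the coordinates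
  other than \<open>j\<close>; \<open>simplex_borel j\<close> is the image of Lebesgue measure in these coordinates,
  restricted to the simplex. It has total mass \<open>1/(K-1)!\<close> and does not depend on \<open>j\<close>
  (lemmas \<open>emeasure_simplex_borel_total\<close> and \<open>simplex_borel_indep\<close> below), so the
  choice of coordinate in \<open>simplex_lebesgue\<close> is immaterial.
\<close>

definition chart :: "'k \<Rightarrow> ('k \<Rightarrow> real) \<Rightarrow> real ^ 'k::finite" where
  "chart j x = (\<chi> i. if i = j then 1 - (\<Sum>l\<in>UNIV - {j}. x l) else x i)"

definition simplex_borel :: "'k \<Rightarrow> (real ^ 'k::finite) measure" where
  "simplex_borel j =
     restrict_space (distr (Pi\<^sub>M (UNIV - {j}) (\<lambda>_. lborel)) borel (chart j)) prob_simplex"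

definition simplex_lebesgue :: "(real ^ 'k::finite) measure" where
  "simplex_lebesgue = completion (simplex_borel (SOME j. True))"

lemma simplex_borel_set [measurable]: "prob_simplex \<in> sets (borel :: (real ^ 'k::finite) measure)"
proof -
  have "closed ({p. \<forall>k. 0 \<le> p $ k} \<inter> {p :: real ^ 'k. (\<Sum>k\<in>UNIV. p $ k) = 1})"
    by (intro closed_Int closed_Collect_all closed_Collect_le closed_Collect_eq
        continuous_intros)
  then show ?thesis
    unfolding prob_simplex_def Collect_conj_eq by (rule borel_closed)
qed

lemma chart_nth: "chart j x $ i = (if i = j then 1 - (\<Sum>l\<in>UNIV - {j}. x l) else x i)"
  by (simp add: chart_def)

lemma chart_measurable [measurable]:
  "chart j \<in> borel_measurable (Pi\<^sub>M (UNIV - {j}) (\<lambda>_. lborel))"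
proof (subst borel_measurable_euclidean_space, rule ballI)
  fix b :: "real ^ 'a" assume "b \<in> Basis"
  then obtain i where b: "b = axis i 1" by (auto simp: Basis_vec_def)
  have "(\<lambda>x. if i = j then 1 - (\<Sum>l\<in>UNIV - {j}. x l) else x i)
      \<in> borel_measurable (Pi\<^sub>M (UNIV - {j}) (\<lambda>_. lborel :: real measure))"
    by (cases "i = j") (auto intro!: borel_measurable_sum)
  then show "(\<lambda>x. chart j x \<bullet> b) \<in> borel_measurable (Pi\<^sub>M (UNIV - {j}) (\<lambda>_. lborel))"
    by (simp add: b cart_eq_inner_axis [symmetric] chart_nth)
qed

lemma sets_simplex_borel: "sets (simplex_borel j) = sets (restrict_space borel prob_simplex)"
  by (simp add: simplex_borel_def sets_restrict_space)

lemma emeasure_simplex_borel: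
  assumes "A \<subseteq> prob_simplex" "A \<in> sets borel"
  shows "emeasure (simplex_borel j) A =
    (\<integral>\<^sup>+x. indicator A (chart j x) \<partial>Pi\<^sub>M (UNIV - {j}) (\<lambda>_. lborel))"
proof -
  have "emeasure (simplex_borel j) A =
      emeasure (distr (Pi\<^sub>M (UNIV - {j}) (\<lambda>_. lborel)) borel (chart j)) A"
    unfolding simplex_borel_def using assms
    by (intro emeasure_restrict_space) (auto simp: simplex_borel_set)
  also have "\<dots> = (\<integral>\<^sup>+x. indicator A x
      \<partial>distr (Pi\<^sub>M (UNIV - {j}) (\<lambda>_. lborel)) borel (chart j))"
    using assms by simp
  also have "\<dots> = (\<integral>\<^sup>+x. indicator A (chart j x) \<partial>Pi\<^sub>M (UNIV - {j}) (\<lambda>_. lborel))"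
    using assms by (intro nn_integral_distr) auto
  finally show ?thesis .
qed

lemma emeasure_simplex_borel_total:
  fixes j :: "'k::finite"
  shows "emeasure (simplex_borel j) prob_simplex = 1 / fact (CARD('k) - 1)"
proof -
  let ?P = "Pi\<^sub>M (UNIV - {j}) (\<lambda>_. lborel :: real measure)"
  let ?S = "{x. (\<forall>i\<in>UNIV - {j}. 0 \<le> x i) \<and> sum x (UNIV - {j}) \<le> 1}"
  have iff: "chart j x \<in> prob_simplex \<longleftrightarrow> x \<in> ?S" for x
  proof -
    have "(\<Sum>k\<in>UNIV. chart j x $ k) = chart j x $ j + (\<Sum>k\<in>UNIV - {j}. chart j x $ k)"
      by (intro sum.remove) auto
    also have "\<dots> = 1"
      by (simp add: chart_nth)
    finally have "(\<Sum>k\<in>UNIV. chart j x $ k) = 1" .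
    then have "chart j x \<in> prob_simplex \<longleftrightarrow> (\<forall>k. 0 \<le> chart j x $ k)"
      by (simp add: prob_simplex_def)
    then show ?thesis
      by (auto simp: chart_nth)
  qed
  have "emeasure (simplex_borel j) prob_simplex
      = emeasure (distr ?P borel (chart j)) prob_simplex"
    unfolding simplex_borel_def
    by (intro emeasure_restrict_space) (auto simp: simplex_borel_set)
  also have "\<dots> = emeasure ?P (?S \<inter> space ?P)"
    by (subst emeasure_distr) (auto simp: iff vimage_def)
  also have "\<dots> = ennreal (1 ^ card (UNIV - {j}) / fact (card (UNIV - {j})))"
    by (intro emeasure_std_simplex_aux) auto
  also have "\<dots> = 1 / fact (CARD('k) - 1)"
    by (simp add: card_Diff_singleton divide_ennreal [symmetric] ennreal_fact)
  finally show ?thesis .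
qed

lemma simplex_borel_indep: "simplex_borel i = simplex_borel j"
proof (cases "i = j")
  case False
  interpret product_sigma_finite "\<lambda>_. lborel :: real measure" by standard
  define R where "R = UNIV - {i, j}"
  have R: "UNIV - {i} = insert j R" "UNIV - {j} = insert i R" "i \<notin> R" "j \<notin> R"
    using False by (auto simp: R_def)
  show ?thesis
  proof (rule measure_eqI)
    show "sets (simplex_borel i) = sets (simplex_borel j)"
      by (simp add: sets_simplex_borel)
    fix A assume "A \<in> sets (simplex_borel i)"
    then have A: "A \<subseteq> prob_simplex" "A \<in> sets borel"
      by (auto simp: sets_simplex_borel sets_restrict_space_iff simplex_borel_set)
    have mi: "(\<lambda>x. indicator A (chart i x) :: ennreal)
        \<in> borel_measurable (Pi\<^sub>M (insert j R) (\<lambda>_. lborel))"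
      and mj: "(\<lambda>x. indicator A (chart j x) :: ennreal)
        \<in> borel_measurable (Pi\<^sub>M (insert i R) (\<lambda>_. lborel))"
      using measurable_compose[OF chart_measurable borel_measurable_indicator[OF A(2)]]
      by (simp_all flip: R)
    have "(\<integral>\<^sup>+y. indicator A (chart i (x(j := y))) \<partial>lborel)
        = (\<integral>\<^sup>+y. indicator A (chart j (x(i := y))) \<partial>lborel)"
      (is "?L = ?R") if x: "x \<in> space (Pi\<^sub>M R (\<lambda>_. lborel :: real measure))" for x
    proof -
      define s where "s = 1 - sum x R"
      have eq: "chart i (x(j := s - y)) = chart j (x(i := y))" for y
      proof -
        have j: "sum (x(j := s - y)) R = sum x R"
          by (rule sum.cong) (use R(4) in auto)
        have i: "sum (x(i := y)) R = sum x R"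
          by (rule sum.cong) (use R(3) in auto)
        have "sum (x(j := s - y)) (UNIV - {i}) = 1 - y"
          unfolding R(1) using R(4) by (subst sum.insert) (simp_all only: j finite, simp_all add: s_def algebra_simps)
        moreover have "sum (x(i := y)) (UNIV - {j}) = 1 - (s - y)"
          unfolding R(2) using R(3) by (subst sum.insert) (simp_all only: i finite, simp_all add: s_def algebra_simps)
        ultimately show ?thesis
          using False by (simp add: vec_eq_iff chart_nth)
      qed
      have "(\<lambda>y. x(j := y)) \<in> measurable lborel (Pi\<^sub>M (insert j R) (\<lambda>_. lborel))"
        using x R(4) by (intro measurable_fun_upd[where J=R]) auto
      from measurable_compose[OF this mi]
      have "?L = (\<integral>\<^sup>+y. indicator A (chart i (x(j := s + (-1) * y))) \<partial>lborel)"
        by (subst nn_integral_real_affine[where c="-1" and t=s]) auto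
      then show ?thesis by (simp add: eq)
    qed
    then have "(\<integral>\<^sup>+x. \<integral>\<^sup>+y. indicator A (chart i (x(j := y))) \<partial>lborel \<partial>Pi\<^sub>M R (\<lambda>_. lborel))
        = (\<integral>\<^sup>+x. \<integral>\<^sup>+y. indicator A (chart j (x(i := y))) \<partial>lborel \<partial>Pi\<^sub>M R (\<lambda>_. lborel))"
      by (rule nn_integral_cong)
    then show "emeasure (simplex_borel i) A = emeasure (simplex_borel j) A"
      using mi mj R(3,4)
      by (simp add: emeasure_simplex_borel[OF A] R(1,2) product_nn_integral_insert)
  qed
qed simp


section \<open>Prior densities\<close>

definition prior_density :: "(real ^ 'k::finite \<Rightarrow> real) \<Rightarrow> bool" where
  "prior_density \<pi> \<longleftrightarrow>
     \<pi> \<in> borel_measurable simplex_lebesgue \<and>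
     (\<forall>p\<in>prob_simplex. 0 \<le> \<pi> p) \<and>
     (\<integral>\<^sup>+p. ennreal (\<pi> p) \<partial>simplex_lebesgue) = 1"

definition condition_P_exp :: "real ^ 'k::finite \<Rightarrow> (real ^ 'k \<Rightarrow> real) \<Rightarrow> bool" where
  "condition_P_exp \<alpha> \<pi> \<longleftrightarrow>
     (let r = (\<lambda>p. \<pi> p / (\<Prod>k\<in>UNIV. (p $ k) powr (\<alpha> $ k - 1))) in
       uniformly_continuous_on simplex_interior r \<and>
       (\<exists>m>0. \<forall>p\<in>simplex_interior. m \<le> r p))"

definition condition_P :: "(real ^ 'k::finite \<Rightarrow> real) \<Rightarrow> bool" where
  "condition_P \<pi> \<longleftrightarrow> (\<exists>\<alpha>. (\<forall>k. 0 < \<alpha> $ k) \<and> condition_P_exp \<alpha> \<pi>)"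


section \<open>Observations and Bayes estimators\<close>

datatype die = Blue | Red

text \<open>
  \<open>die i \<omega>\<close> and \<open>side i \<omega>\<close> are the die tossed in period \<open>i\<close> and the side it lands on;
  periods are numbered from 1, and the values at period 0 are never used. The observation
  \<open>X\<^sup>n\<close> is a function on \<open>{1..n}\<close>.
\<close>

definition observation ::
  "(nat \<Rightarrow> 'w \<Rightarrow> die) \<Rightarrow> (nat \<Rightarrow> 'w \<Rightarrow> 'k) \<Rightarrow> nat \<Rightarrow> 'w \<Rightarrow> nat \<Rightarrow> die \<times> 'k" where
  "observation die side n \<omega> = (\<lambda>i\<in>{1..n}. (die i \<omega>, side i \<omega>))"

definition blue_count :: "(nat \<Rightarrow> 'w \<Rightarrow> die) \<Rightarrow> nat \<Rightarrow> 'w \<Rightarrow> nat" where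
  "blue_count die n \<omega> = card {i\<in>{1..n}. die i \<omega> = Blue}"

definition side_count :: "die \<Rightarrow> nat \<Rightarrow> (nat \<Rightarrow> die \<times> 'k) \<Rightarrow> 'k \<Rightarrow> nat" where
  "side_count d n x k = card {i\<in>{1..n}. x i = (d, k)}"

definition posterior_mean ::
  "(real ^ 'k::finite \<Rightarrow> real) \<Rightarrow> ('k \<Rightarrow> nat) \<Rightarrow> 'k \<Rightarrow> real" where
  "posterior_mean \<pi> y k =
     (\<integral>p. p $ k * (\<Prod>i\<in>UNIV. (p $ i) ^ y i) * \<pi> p \<partial>simplex_lebesgue) /
     (\<integral>p. (\<Prod>i\<in>UNIV. (p $ i) ^ y i) * \<pi> p \<partial>simplex_lebesgue)"

definition p_hat ::
  "(real ^ 'k::finite \<Rightarrow> real) \<Rightarrow> nat \<Rightarrow> (nat \<Rightarrow> die \<times> 'k) \<Rightarrow> 'k \<Rightarrow> real" where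
  "p_hat \<pi> n x k = posterior_mean \<pi> (side_count Blue n x) k"

definition q_hat ::
  "(real ^ 'k::finite \<Rightarrow> real) \<Rightarrow> nat \<Rightarrow> (nat \<Rightarrow> die \<times> 'k) \<Rightarrow> 'k \<Rightarrow> real" where
  "q_hat \<rho> n x k = posterior_mean \<rho> (side_count Red n x) k"


section \<open>The tossing process\<close>

text \<open>
  The process under a fixed parameter \<open>(p, q)\<close>. Since \<open>X\<^sup>n\<close> takes finitely many values, the
  two families of events in \<open>die_indep\<close> are the sigma-algebras generated by \<open>X\<^sup>n\<close> and by the
  choice in period \<open>n + 1\<close>. The conditional probabilities are prescribed only where they are defined.
\<close>

locale dice_process = prob_space M
  for M :: "'w measure" +
  fixes b :: "nat \<Rightarrow> real"
    and p q :: "real ^ 'k::finite"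
    and die :: "nat \<Rightarrow> 'w \<Rightarrow> die"
    and side :: "nat \<Rightarrow> 'w \<Rightarrow> 'k"
  assumes die_measurable: "\<And>n. 1 \<le> n \<Longrightarrow> die n \<in> measurable M (count_space UNIV)"
    and side_measurable: "\<And>n. 1 \<le> n \<Longrightarrow> side n \<in> measurable M (count_space UNIV)"
    and die_prob: "\<And>n. 1 \<le> n \<Longrightarrow> \<P>(\<omega> in M. die n \<omega> = Blue) = b n"
    and die_indep: "\<And>n. indep_set
          {observation die side n -` A \<inter> space M | A. True}
          {die (Suc n) -` D \<inter> space M | D. True}"
    and blue_side: "\<And>n x k.
          \<P>(\<omega> in M. observation die side n \<omega> = x \<and> die (Suc n) \<omega> = Blue) > 0 \<Longrightarrow>
          \<P>(\<omega> in M. side (Suc n) \<omega> = k \<bar>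
               observation die side n \<omega> = x \<and> die (Suc n) \<omega> = Blue) = p $ k"
    and red_side: "\<And>n x k.
          \<P>(\<omega> in M. observation die side n \<omega> = x \<and> die (Suc n) \<omega> = Red) > 0 \<Longrightarrow>
          \<P>(\<omega> in M. side (Suc n) \<omega> = k \<bar>
               observation die side n \<omega> = x \<and> die (Suc n) \<omega> = Red) = q $ k"

end

theory Submission
  imports Defs
begin

text \<open>
  If \<open>\<pi>(p) = r(p) \<Prod> p\<^sub>i\<^bsup>\<alpha>\<^sub>i - 1\<^esup>\<close> with \<open>r\<close> uniformly continuous and bounded away from zero, then the
  posterior after counts \<open>y\<close> is a Dirichlet distribution with exponents \<open>\<beta> = y + \<alpha>\<close>, reweighted by \<open>r\<close>.
  Since \<open>p\<^sub>k\<close> times the Dirichlet kernel of \<open>\<beta>\<close> is the kernel of \<open>\<beta> + e\<^sub>k\<close>, the posterior mean equals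
  \<open>\<beta>\<^sub>k / |\<beta>|\<close> times a ratio of two Dirichlet expectations of \<open>r\<close>. Both distributions have variance of
  order \<open>1 / |\<beta>|\<close> and almost the same mean, so this ratio tends to 1 uniformly in \<open>y\<close> as \<open>|\<beta>|\<close> grows.
  The moments of the Dirichlet kernel follow from the identity
  \<open>\<beta>\<^sub>j \<integral>p\<^sub>i h\<^sub>\<beta> = \<beta>\<^sub>i \<integral>p\<^sub>j h\<^sub>\<beta>\<close>, summed over \<open>j\<close>.

  On the side of the observations, with \<open>Y\<close>, \<open>Z\<close> the numbers of blue and red tosses landing on side \<open>k\<close>
  and \<open>B\<close>, \<open>R\<close> the numbers of blue and red tosses, \<open>Y - p\<^sub>k B\<close> and \<open>Z - q\<^sub>k R\<close> are sums of
  orthogonal increments with second moments at most \<open>n p\<^sub>k\<close> and \<open>n q\<^sub>k \<le> n p\<^sub>k / c\<close>, so by Chebyshev both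
  are small relative to \<open>n p\<^sub>k\<close> with probability \<open>1 - O(1 / (n p\<^sub>k))\<close>, while \<open>B\<close> and \<open>R\<close> are of order \<open>n\<close>.
\<close>

section \<open>Dirichlet integrals\<close>

text \<open>Substituting \<open>y = s * u\<close>, the two powers contribute
  \<open>s powr (a + b - 2)\<close> and the change of variables one more factor \<open>s\<close>;
  Euler's Beta integral remains.\<close>

lemma nn_integral_beta_scaled:
  fixes a b s :: real
  assumes "a > 0" "b > 0" "s > 0"
  shows "(\<integral>\<^sup>+y. ennreal (y powr (a - 1) * (s - y) powr (b - 1)) * indicator {0..s} y \<partial>lborel)
    = ennreal (s powr (a + b - 1) * Beta a b)"
proof -
  have "(\<integral>\<^sup>+y. ennreal (y powr (a - 1) * (s - y) powr (b - 1)) * indicator {0..s} y \<partial>lborel)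
    = ennreal s * (\<integral>\<^sup>+u. ennreal ((s * u) powr (a - 1) * (s - s * u) powr (b - 1)) * indicator {0..s} (s * u) \<partial>lborel)"
    using nn_integral_real_affine[of "\<lambda>y. ennreal (y powr (a - 1) * (s - y) powr (b - 1)) * indicator {0..s} y" s 0] assms
    by simp
  also have "(\<lambda>u. ennreal ((s * u) powr (a - 1) * (s - s * u) powr (b - 1)) * indicator {0..s} (s * u))
    = (\<lambda>u. ennreal (s powr (a + b - 2)) * (ennreal (u powr (a - 1) * (1 - u) powr (b - 1)) * indicator {0..1} u))"
  proof
    fix u
    show "ennreal ((s * u) powr (a - 1) * (s - s * u) powr (b - 1)) * indicator {0..s} (s * u)
      = ennreal (s powr (a + b - 2)) * (ennreal (u powr (a - 1) * (1 - u) powr (b - 1)) * indicator {0..1} u)"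
    proof (cases "0 \<le> u \<and> u \<le> 1")
      case True
      have "(s * u) powr (a - 1) * (s * (1 - u)) powr (b - 1)
        = (s powr (a - 1) * s powr (b - 1)) * (u powr (a - 1) * (1 - u) powr (b - 1))"
        using True assms by (simp add: powr_mult)
      also have "s powr (a - 1) * s powr (b - 1) = s powr (a + b - 2)"
        by (simp add: powr_add [symmetric] algebra_simps)
      finally have "(s * u) powr (a - 1) * (s - s * u) powr (b - 1)
        = s powr (a + b - 2) * (u powr (a - 1) * (1 - u) powr (b - 1))"
        by (simp add: algebra_simps)
      moreover have "0 \<le> s * u" "s * u \<le> s"
        using True assms by (auto simp: mult_left_le)
      ultimately show ?thesis
        using True by (simp add: ennreal_mult'')
    next
      case False
      then have "\<not> (0 \<le> s * u \<and> s * u \<le> s)"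
        using assms by (auto simp: zero_le_mult_iff)
      then show ?thesis using False by auto
    qed
  qed
  also have "(\<integral>\<^sup>+u. ennreal (s powr (a + b - 2)) * (ennreal (u powr (a - 1) * (1 - u) powr (b - 1)) * indicator {0..1} u) \<partial>lborel)
    = ennreal (s powr (a + b - 2)) * ennreal (Beta a b)"
    by (subst nn_integral_cmult, simp,
        subst nn_integral_has_integral_lebesgue'[OF _ has_integral_Beta_real[OF assms(1,2)]]) auto
  also have "ennreal s * (ennreal (s powr (a + b - 2)) * ennreal (Beta a b))
    = ennreal (s * s powr (a + b - 2) * Beta a b)"
    using assms by (simp add: ennreal_mult' [symmetric] mult.assoc)
  also have "s * s powr (a + b - 2) = s powr (a + b - 1)"
    using assms by (simp add: powr_mult_base algebra_simps)
  finally show ?thesis .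
qed

text \<open>The recursions (a+b) B(a+1,b) = a B(a,b) and (a+b) B(a,b+1) = b B(a,b) give b B(a+1,b) =
  a B(a,b+1), and both integrals carry the same power of \<open>s\<close>. Every real
  \<open>s\<close> is allowed because \<open>s\<close> will be the mass left to two coordinates
  after the others are fixed arbitrarily.\<close>

lemma beta_exchange:
  fixes a b s :: real
  assumes "a > 0" "b > 0"
  shows "ennreal b * (\<integral>\<^sup>+y. ennreal (y powr a * (s - y) powr (b - 1)) * indicator {0..s} y \<partial>lborel)
    = ennreal a * (\<integral>\<^sup>+y. ennreal (y powr (a - 1) * (s - y) powr b) * indicator {0..s} y \<partial>lborel)"
proof (cases "s > 0")
  case True
  have "(a + b) * (b * Beta (a + 1) b) = (a + b) * (a * Beta a (b + 1))"
    using Beta_plus1_left[of a b] Beta_plus1_right[of b a] assms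
    by (metis mult.left_commute nonpos_Ints_nonpos not_le)
  then have "b * Beta (a + 1) b = a * Beta a (b + 1)"
    using assms by simp
  then have "b * (s powr (a + b) * Beta (a + 1) b) = a * (s powr (a + b) * Beta a (b + 1))"
    by (metis mult.left_commute)
  moreover have "ennreal b * (\<integral>\<^sup>+y. ennreal (y powr a * (s - y) powr (b - 1)) * indicator {0..s} y \<partial>lborel)
      = ennreal (b * (s powr (a + b) * Beta (a + 1) b))"
    using nn_integral_beta_scaled[of "a + 1" b s] assms True by (simp add: ennreal_mult')
  moreover have "ennreal a * (\<integral>\<^sup>+y. ennreal (y powr (a - 1) * (s - y) powr b) * indicator {0..s} y \<partial>lborel)
      = ennreal (a * (s powr (a + b) * Beta a (b + 1)))"
    using nn_integral_beta_scaled[of a "b + 1" s] assms True by (simp add: ennreal_mult')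
  ultimately show ?thesis
    by (simp only:)
next
  case False
  \<comment> \<open>For s \<le> 0 the interval is empty or the single point 0, a null set.\<close>
  have "(\<integral>\<^sup>+y. f y * indicator {0..s} y \<partial>lborel) = 0" for f :: "real \<Rightarrow> ennreal"
  proof -
    have "AE y in lborel. y \<noteq> (0::real)"
      by (rule AE_lborel_singleton)
    then have "AE y in lborel. f y * indicator {0..s} y = 0"
      by eventually_elim (use False in auto)
    then show ?thesis
      by (subst nn_integral_cong_AE[where v="\<lambda>_. 0"]) auto
  qed
  then show ?thesis by simp
qed

section \<open>Integration over the simplex in chart coordinates\<close>

lemma simplex_lebesgue_eq: "simplex_lebesgue = completion (simplex_borel j)"
  unfolding simplex_lebesgue_def by (subst simplex_borel_indep[of _ j]) (rule refl)

lemma space_simplex_lebesgue [simp]: "space simplex_lebesgue = prob_simplex"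
  by (simp add: simplex_lebesgue_def simplex_borel_def space_restrict_space)

lemma borel_measurable_simplex_lebesgue:
  "f \<in> borel_measurable borel \<Longrightarrow> f \<in> borel_measurable simplex_lebesgue"
  unfolding simplex_lebesgue_def
  by (rule measurable_completion)
     (simp add: simplex_borel_def measurable_restrict_space1 cong: measurable_cong_sets)

lemma chart_in_prob_simplex_iff:
  "chart j x \<in> prob_simplex \<longleftrightarrow> (\<forall>i. i \<noteq> j \<longrightarrow> 0 \<le> x i) \<and> sum x (UNIV - {j}) \<le> 1"
proof -
  have "(\<Sum>k\<in>UNIV. chart j x $ k) = chart j x $ j + (\<Sum>k\<in>UNIV - {j}. chart j x $ k)"
    by (intro sum.remove) auto
  also have "\<dots> = 1"
    by (simp add: chart_nth)
  finally have "(\<Sum>k\<in>UNIV. chart j x $ k) = 1" .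
  then have "chart j x \<in> prob_simplex \<longleftrightarrow> (\<forall>k. 0 \<le> chart j x $ k)"
    by (simp add: prob_simplex_def)
  then show ?thesis
    by (auto simp: chart_nth)
qed

lemma nn_integral_simplex:
  fixes f :: "real ^ 'k::finite \<Rightarrow> ennreal"
  assumes [measurable]: "f \<in> borel_measurable borel"
  shows "(\<integral>\<^sup>+p. f p \<partial>simplex_lebesgue)
    = (\<integral>\<^sup>+x. f (chart j x) * indicator prob_simplex (chart j x) \<partial>Pi\<^sub>M (UNIV - {j}) (\<lambda>_. lborel))"
  unfolding simplex_lebesgue_eq[of j] nn_integral_completion simplex_borel_def
  by (subst nn_integral_restrict_space, simp add: simplex_borel_set)
     (subst nn_integral_distr, simp_all)

text \<open>By Fubini, only coordinates \<open>i\<close> and \<open>j\<close> of the point vary in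
  the inner integral, so questions about a pair of coordinates become one-dimensional.\<close>

lemma nn_integral_simplex_insert:
  fixes f :: "real ^ 'k::finite \<Rightarrow> ennreal"
  assumes f [measurable]: "f \<in> borel_measurable borel" and "i \<noteq> j"
  shows "(\<integral>\<^sup>+p. f p \<partial>simplex_lebesgue)
    = (\<integral>\<^sup>+x. \<integral>\<^sup>+y. f (chart j (x(i := y))) * indicator prob_simplex (chart j (x(i := y))) \<partial>lborel
        \<partial>Pi\<^sub>M (UNIV - {i, j}) (\<lambda>_. lborel))"
proof -
  interpret product_sigma_finite "\<lambda>_. lborel :: real measure" by standard
  have ins: "UNIV - {j} = insert i (UNIV - {i, j})" using \<open>i \<noteq> j\<close> by auto
  have [measurable]: "(\<lambda>x. f (chart j x) * indicator prob_simplex (chart j x))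
    \<in> borel_measurable (Pi\<^sub>M (UNIV - {j}) (\<lambda>_. lborel))"
    by measurable
  then have "(\<lambda>x. f (chart j x) * indicator prob_simplex (chart j x))
    \<in> borel_measurable (Pi\<^sub>M (insert i (UNIV - {i, j})) (\<lambda>_. lborel))"
    by (simp flip: ins)
  then show ?thesis
    unfolding nn_integral_simplex[OF f, of j] ins
    by (subst product_nn_integral_insert) auto
qed

lemma chart_fun_upd:
  assumes "i \<noteq> j"
  shows "chart j (x(i := y)) =
    (\<chi> l. if l = j then (1 - sum x (UNIV - {i, j})) - y else if l = i then y else x l)"
proof -
  have "UNIV - {j} = insert i (UNIV - {i, j})" using assms by auto
  then have "(\<Sum>l\<in>UNIV - {j}. (x(i := y)) l) = y + (\<Sum>l\<in>UNIV - {i, j}. (x(i := y)) l)"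
    by (simp add: sum.insert)
  also have "(\<Sum>l\<in>UNIV - {i, j}. (x(i := y)) l) = sum x (UNIV - {i, j})"
    by (rule sum.cong) auto
  finally show ?thesis
    by (simp add: vec_eq_iff chart_nth)
qed

text \<open>In a chart omitting some \<open>j\<close> other than \<open>i\<close>, the face where
  coordinate \<open>i\<close> vanishes is \<open>y = 0\<close> in the inner integral, a null set.
  Condition P speaks of the interior alone, so the later integral comparisons rest on this.\<close>

lemma AE_simplex_interior:
  assumes "CARD('k::finite) \<ge> 2"
  shows "AE p in simplex_lebesgue. p \<in> (simplex_interior :: (real ^ 'k) set)"
proof -
  have "AE p in simplex_lebesgue. p $ i \<noteq> 0" for i :: 'k
  proof -
    have "\<exists>j. i \<noteq> j"
    proof (rule ccontr)
      assume "\<nexists>j. i \<noteq> j"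
      then have "UNIV = {i}" by auto
      then have "CARD('k) = card {i}" by (rule arg_cong)
      then show False using assms by simp
    qed
    then obtain j where "i \<noteq> j" ..
    have [measurable]: "{p :: real ^ 'k. p $ i = 0} \<in> sets borel"
      by (intro borel_closed closed_Collect_eq continuous_intros)
    have inner: "(\<integral>\<^sup>+y. indicator {p. p $ i = 0} (chart j (x(i := y))) *
        indicator prob_simplex (chart j (x(i := y))) \<partial>lborel) = 0" for x :: "'k \<Rightarrow> real"
    proof -
      have "AE y in lborel. (indicator {p. p $ i = 0} (chart j (x(i := y))) *
          indicator prob_simplex (chart j (x(i := y))) :: ennreal) = 0"
        using AE_lborel_singleton[of "0::real"]
        by eventually_elim (use \<open>i \<noteq> j\<close> in \<open>auto simp: chart_fun_upd\<close>)
      then show ?thesis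
        by (subst nn_integral_cong_AE[where v="\<lambda>_. 0"]) auto
    qed
    have "(\<integral>\<^sup>+p. indicator {p. p $ i = 0} p \<partial>simplex_lebesgue) = 0"
      by (subst nn_integral_simplex_insert[OF _ \<open>i \<noteq> j\<close>]) (simp_all add: inner)
    then have "AE p in simplex_lebesgue. (indicator {p. p $ i = 0} p :: ennreal) = 0"
      by (subst (asm) nn_integral_0_iff_AE) (auto intro: borel_measurable_simplex_lebesgue)
    then show ?thesis
      by eventually_elim (auto simp: indicator_def split: if_splits)
  qed
  then have "AE p in simplex_lebesgue. \<forall>i::'k. p $ i \<noteq> 0"
    by (simp add: AE_all_countable)
  moreover have "AE p in simplex_lebesgue. p \<in> (prob_simplex :: (real ^ 'k) set)"
    by (rule AE_I2) simp
  ultimately show ?thesis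
    by eventually_elim (simp add: simplex_interior_def prob_simplex_def less_le)
qed

section \<open>The Dirichlet kernel and its first moments\<close>

text \<open>The Dirichlet density without its normalizing constant, which is never computed. Since
  \<open>0 powr x = 0\<close>, it vanishes wherever some coordinate is 0, whatever the
  exponents.\<close>

definition dirichlet_kernel :: "real ^ 'k::finite \<Rightarrow> real ^ 'k \<Rightarrow> real" where
  "dirichlet_kernel \<beta> p = (\<Prod>i\<in>UNIV. (p $ i) powr (\<beta> $ i - 1))"

lemma borel_measurable_dirichlet_kernel [measurable]:
  "dirichlet_kernel \<beta> \<in> borel_measurable borel"
  unfolding dirichlet_kernel_def by measurable

lemma dirichlet_kernel_nonneg [simp]: "0 \<le> dirichlet_kernel \<beta> p"
  unfolding dirichlet_kernel_def by (simp add: prod_nonneg)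

lemma dirichlet_kernel_pos: "p \<in> simplex_interior \<Longrightarrow> 0 < dirichlet_kernel \<beta> p"
  unfolding dirichlet_kernel_def simplex_interior_def
  by (intro prod_pos) (metis (mono_tags, lifting) less_irrefl mem_Collect_eq powr_gt_zero)

text \<open>
  In the chart omitting coordinate \<open>j\<close>, with all coordinates except \<open>i\<close> and \<open>j\<close> fixed, this is
  the one-dimensional identity \<open>beta_exchange\<close>.
\<close>

lemma dirichlet_exchange_nn:
  fixes \<beta> :: "real ^ 'k::finite"
  assumes "i \<noteq> j" "\<And>l. 0 < \<beta> $ l"
  shows "ennreal (\<beta> $ j) * (\<integral>\<^sup>+p. ennreal (p $ i * dirichlet_kernel \<beta> p) \<partial>simplex_lebesgue)
    = ennreal (\<beta> $ i) * (\<integral>\<^sup>+p. ennreal (p $ j * dirichlet_kernel \<beta> p) \<partial>simplex_lebesgue)"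
proof -
  let ?P = "Pi\<^sub>M (UNIV - {i, j}) (\<lambda>_. lborel :: real measure)"
  \<comment> \<open>\<open>C\<close> is the part of the kernel that is constant in the inner
    integral, \<open>s\<close> the mass left to coordinates \<open>i\<close> and \<open>j\<close>,
    and \<open>A\<close> the sign condition on the outer variables.\<close>
  define C :: "('k \<Rightarrow> real) \<Rightarrow> real" where "C x = (\<Prod>l\<in>UNIV - {i, j}. (x l) powr (\<beta> $ l - 1))" for x
  define s :: "('k \<Rightarrow> real) \<Rightarrow> real" where "s x = 1 - sum x (UNIV - {i, j})" for x
  define A where "A = {x :: 'k \<Rightarrow> real. \<forall>l. l \<noteq> i \<and> l \<noteq> j \<longrightarrow> 0 \<le> x l}"
  have C: "0 \<le> C x" for x unfolding C_def by (simp add: prod_nonneg)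
  have UN: "UNIV = insert i (insert j (UNIV - {i, j}))" by auto
  have kern: "dirichlet_kernel \<beta> (chart j (x(i := y)))
    = y powr (\<beta> $ i - 1) * (s x - y) powr (\<beta> $ j - 1) * C x" for x y
  proof -
    let ?f = "\<lambda>l. (chart j (x(i := y)) $ l) powr (\<beta> $ l - 1)"
    have "dirichlet_kernel \<beta> (chart j (x(i := y))) = ?f i * ?f j * prod ?f (UNIV - {i, j})"
      unfolding dirichlet_kernel_def by (subst UN) (use assms(1) in \<open>simp add: prod.insert\<close>)
    also have "prod ?f (UNIV - {i, j}) = C x"
      unfolding C_def by (rule prod.cong) (use assms(1) in \<open>auto simp: chart_fun_upd\<close>)
    moreover have "?f i = y powr (\<beta> $ i - 1)" "?f j = (s x - y) powr (\<beta> $ j - 1)"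
      unfolding chart_fun_upd[OF assms(1)] s_def using assms(1) by simp_all
    ultimately show ?thesis by simp
  qed
  have ind: "indicator prob_simplex (chart j (x(i := y)))
    = (indicator A x * indicator {0..s x} y :: ennreal)" for x y
  proof -
    have "sum (x(i := y)) (UNIV - {j}) = y + sum (x(i := y)) (UNIV - {i, j})"
    proof -
      have "UNIV - {j} = insert i (UNIV - {i, j})" using assms(1) by auto
      then show ?thesis by (simp add: sum.insert)
    qed
    also have "sum (x(i := y)) (UNIV - {i, j}) = sum x (UNIV - {i, j})"
      by (rule sum.cong) auto
    finally have "chart j (x(i := y)) \<in> prob_simplex \<longleftrightarrow> x \<in> A \<and> y \<in> {0..s x}"
      unfolding chart_in_prob_simplex_iff A_def s_def using assms(1) by auto
    then show ?thesis
      by (simp add: indicator_def)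
  qed
  \<comment> \<open>For fixed \<open>x\<close> both sides have the common factor \<open>C x\<close>
    times the indicator of \<open>A\<close>; what remains is \<open>beta_exchange\<close>.\<close>
  have inner: "ennreal (\<beta> $ j) * (\<integral>\<^sup>+y. ennreal (chart j (x(i := y)) $ i * dirichlet_kernel \<beta> (chart j (x(i := y))))
        * indicator prob_simplex (chart j (x(i := y))) \<partial>lborel)
    = ennreal (\<beta> $ i) * (\<integral>\<^sup>+y. ennreal (chart j (x(i := y)) $ j * dirichlet_kernel \<beta> (chart j (x(i := y))))
        * indicator prob_simplex (chart j (x(i := y))) \<partial>lborel)" (is "_ * ?L = _ * ?R") for x
  proof -
    have "?L = (\<integral>\<^sup>+y. ennreal (C x) * indicator A x *
        (ennreal (y powr (\<beta> $ i) * (s x - y) powr (\<beta> $ j - 1)) * indicator {0..s x} y) \<partial>lborel)"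
    proof (rule nn_integral_cong)
      fix y
      \<comment> \<open>The extra factor \<open>y\<close> is absorbed into the power where
        \<open>0 \<le> y\<close>; elsewhere the indicator vanishes.\<close>
      have "y * y powr (\<beta> $ i - 1) = y powr (\<beta> $ i)" if "0 \<le> y"
        using that by (simp add: powr_mult_base)
      then have "0 \<le> y \<Longrightarrow> chart j (x(i := y)) $ i * dirichlet_kernel \<beta> (chart j (x(i := y)))
          = C x * (y powr (\<beta> $ i) * (s x - y) powr (\<beta> $ j - 1))"
        unfolding kern using assms(1) by (simp add: chart_fun_upd algebra_simps)
      then show "ennreal (chart j (x(i := y)) $ i * dirichlet_kernel \<beta> (chart j (x(i := y))))
          * indicator prob_simplex (chart j (x(i := y))) = ennreal (C x) * indicator A x *
        (ennreal (y powr (\<beta> $ i) * (s x - y) powr (\<beta> $ j - 1)) * indicator {0..s x} y)"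
        unfolding ind using C by (auto simp: indicator_def ennreal_mult')
    qed
    also have "\<dots> = ennreal (C x) * indicator A x *
        (\<integral>\<^sup>+y. ennreal (y powr (\<beta> $ i) * (s x - y) powr (\<beta> $ j - 1)) * indicator {0..s x} y \<partial>lborel)"
      by (rule nn_integral_cmult) measurable
    finally have L: "?L = \<dots>" .
    have "?R = (\<integral>\<^sup>+y. ennreal (C x) * indicator A x *
        (ennreal (y powr (\<beta> $ i - 1) * (s x - y) powr (\<beta> $ j)) * indicator {0..s x} y) \<partial>lborel)"
    proof (rule nn_integral_cong)
      fix y
      have "(s x - y) * (s x - y) powr (\<beta> $ j - 1) = (s x - y) powr (\<beta> $ j)" if "y \<le> s x"
        using that by (simp add: powr_mult_base)
      then have "y \<le> s x \<Longrightarrow> chart j (x(i := y)) $ j * dirichlet_kernel \<beta> (chart j (x(i := y)))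
          = C x * (y powr (\<beta> $ i - 1) * (s x - y) powr (\<beta> $ j))"
        unfolding kern using assms(1) by (simp add: chart_fun_upd s_def [symmetric] mult_ac)
      then show "ennreal (chart j (x(i := y)) $ j * dirichlet_kernel \<beta> (chart j (x(i := y))))
          * indicator prob_simplex (chart j (x(i := y))) = ennreal (C x) * indicator A x *
        (ennreal (y powr (\<beta> $ i - 1) * (s x - y) powr (\<beta> $ j)) * indicator {0..s x} y)"
        unfolding ind using C by (auto simp: indicator_def ennreal_mult')
    qed
    also have "\<dots> = ennreal (C x) * indicator A x *
        (\<integral>\<^sup>+y. ennreal (y powr (\<beta> $ i - 1) * (s x - y) powr (\<beta> $ j)) * indicator {0..s x} y \<partial>lborel)"
      by (rule nn_integral_cmult) measurable
    finally have R: "?R = \<dots>" .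
    show ?thesis
      unfolding L R using beta_exchange[OF assms(2)[of i] assms(2)[of j], of "s x"]
      by (simp only: mult.left_commute[of _ "ennreal (C x) * indicator A x"])
  qed
  have [measurable]: "(\<lambda>p. ennreal (p $ l * dirichlet_kernel \<beta> p)) \<in> borel_measurable borel" for l
    by measurable
  interpret product_sigma_finite "\<lambda>_. lborel :: real measure" by standard
  have meas: "(\<lambda>x. \<integral>\<^sup>+y. ennreal (chart j (x(i := y)) $ l * dirichlet_kernel \<beta> (chart j (x(i := y))))
        * indicator prob_simplex (chart j (x(i := y))) \<partial>lborel) \<in> borel_measurable ?P" for l
  proof -
    have ins: "UNIV - {j} = insert i (UNIV - {i, j})" using \<open>i \<noteq> j\<close> by auto
    have [measurable]: "(\<lambda>x. ennreal (chart j x $ l * dirichlet_kernel \<beta> (chart j x)) * indicator prob_simplex (chart j x))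
      \<in> borel_measurable (Pi\<^sub>M (insert i (UNIV - {i, j})) (\<lambda>_. lborel))"
      unfolding ins[symmetric] by measurable
    show ?thesis
      by measurable
  qed
  show ?thesis
    by (subst (1 2) nn_integral_simplex_insert[where i = i and j = j])
       (use assms(1) meas inner in \<open>simp_all add: nn_integral_cmult [symmetric]\<close>)
qed

lemma prob_simplex_nth:
  "p \<in> prob_simplex \<Longrightarrow> 0 \<le> p $ i" "p \<in> prob_simplex \<Longrightarrow> p $ i \<le> 1"
  "p \<in> prob_simplex \<Longrightarrow> (\<Sum>i\<in>UNIV. p $ i) = 1"
proof -
  show nn: "0 \<le> p $ i" if "p \<in> prob_simplex" for i
    using that by (simp add: prob_simplex_def)
  show 1: "(\<Sum>i\<in>UNIV. p $ i) = 1" if "p \<in> prob_simplex"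
    using that by (simp add: prob_simplex_def)
  show "p $ i \<le> 1" if "p \<in> prob_simplex"
    using member_le_sum[of i UNIV "\<lambda>i. p $ i"] nn[OF that] 1[OF that] by simp
qed

lemma simplex_interior_subset: "simplex_interior \<subseteq> prob_simplex"
  by (auto simp: simplex_interior_def)

lemma integrable_nth_mult_simplex:
  assumes "integrable simplex_lebesgue f"
  shows "integrable simplex_lebesgue (\<lambda>p. p $ i * f p)"
proof (rule Bochner_Integration.integrable_bound[OF assms])
  have "(\<lambda>p. p $ i) \<in> borel_measurable simplex_lebesgue"
    by (rule borel_measurable_simplex_lebesgue) measurable
  then show "(\<lambda>p. p $ i * f p) \<in> borel_measurable simplex_lebesgue"
    using assms by measurable
  show "AE p in simplex_lebesgue. norm (p $ i * f p) \<le> norm (f p)"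
    by (rule AE_I2) (auto simp: abs_mult prob_simplex_nth intro!: mult_left_le_one_le)
qed

text \<open>Integrability is a hypothesis here and below: it will be obtained from the prior
  (\<open>integrable_alpha\<close>) rather than from a formula for the integral.\<close>

lemma dirichlet_exchange:
  fixes \<beta> :: "real ^ 'k::finite"
  assumes "\<And>l. 0 < \<beta> $ l" and int: "integrable simplex_lebesgue (dirichlet_kernel \<beta>)"
  shows "\<beta> $ j * (\<integral>p. p $ i * dirichlet_kernel \<beta> p \<partial>simplex_lebesgue)
    = \<beta> $ i * (\<integral>p. p $ j * dirichlet_kernel \<beta> p \<partial>simplex_lebesgue)"
proof (cases "i = j")
  case False
  have nonneg: "AE p in simplex_lebesgue. 0 \<le> p $ l * dirichlet_kernel \<beta> p" for l
    by (rule AE_I2) (simp add: prob_simplex_nth)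
  have "ennreal (\<integral>p. p $ l * dirichlet_kernel \<beta> p \<partial>simplex_lebesgue)
      = (\<integral>\<^sup>+p. ennreal (p $ l * dirichlet_kernel \<beta> p) \<partial>simplex_lebesgue)" for l
    by (rule nn_integral_eq_integral[symmetric, OF integrable_nth_mult_simplex[OF int] nonneg])
  moreover have int_nn: "0 \<le> (\<integral>p. p $ l * dirichlet_kernel \<beta> p \<partial>simplex_lebesgue)" for l
    by (rule integral_nonneg_AE[OF nonneg])
  moreover have beta_nn: "0 \<le> \<beta> $ l" for l
    using assms(1)[of l] by simp
  moreover have "ennreal (\<beta> $ j) * (\<integral>\<^sup>+p. ennreal (p $ i * dirichlet_kernel \<beta> p) \<partial>simplex_lebesgue)
      = ennreal (\<beta> $ i) * (\<integral>\<^sup>+p. ennreal (p $ j * dirichlet_kernel \<beta> p) \<partial>simplex_lebesgue)"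
    by (rule dirichlet_exchange_nn[OF False assms(1)])
  ultimately have "ennreal (\<beta> $ j * (\<integral>p. p $ i * dirichlet_kernel \<beta> p \<partial>simplex_lebesgue))
      = ennreal (\<beta> $ i * (\<integral>p. p $ j * dirichlet_kernel \<beta> p \<partial>simplex_lebesgue))"
    by (simp only: ennreal_mult)
  then show ?thesis
    by (rule ennreal_inj[THEN iffD1, rotated 2]) (simp_all add: int_nn beta_nn)
qed simp

text \<open>Summed over \<open>j\<close>, the left side of the exchange identity is the sum of the
  exponents times the moment; the right side is \<open>\<beta> $ i\<close> times the integral of the
  kernel, because the coordinates add up to 1.\<close>

lemma dirichlet_first_moment:
  fixes \<beta> :: "real ^ 'k::finite"
  assumes pos: "\<And>l. 0 < \<beta> $ l" and int: "integrable simplex_lebesgue (dirichlet_kernel \<beta>)"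
  shows "(\<integral>p. p $ i * dirichlet_kernel \<beta> p \<partial>simplex_lebesgue)
    = \<beta> $ i / (\<Sum>l\<in>UNIV. \<beta> $ l) * (\<integral>p. dirichlet_kernel \<beta> p \<partial>simplex_lebesgue)"
proof -
  let ?I = "\<lambda>i. \<integral>p. p $ i * dirichlet_kernel \<beta> p \<partial>simplex_lebesgue"
  have "(\<Sum>l\<in>UNIV. \<beta> $ l) * ?I i = (\<Sum>j\<in>UNIV. \<beta> $ i * ?I j)"
    unfolding sum_distrib_right using dirichlet_exchange[OF assms] by (intro sum.cong) auto
  also have "\<dots> = \<beta> $ i * (\<integral>p. (\<Sum>j\<in>UNIV. p $ j * dirichlet_kernel \<beta> p) \<partial>simplex_lebesgue)"
    using integrable_nth_mult_simplex[OF int]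
    by (subst Bochner_Integration.integral_sum) (auto simp: sum_distrib_left)
  also have "(\<integral>p. (\<Sum>j\<in>UNIV. p $ j * dirichlet_kernel \<beta> p) \<partial>simplex_lebesgue)
      = (\<integral>p. dirichlet_kernel \<beta> p \<partial>simplex_lebesgue)"
    by (intro Bochner_Integration.integral_cong)
       (simp_all add: sum_distrib_right [symmetric] prob_simplex_nth)
  moreover have "0 < (\<Sum>l\<in>UNIV. \<beta> $ l)"
    using pos by (intro sum_pos) auto
  ultimately show ?thesis
    by (simp add: field_simps)
qed

text \<open>A factor \<open>p $ i\<close> only changes the exponent, so second moments and the
  numerators of posterior means are again Dirichlet integrals.\<close>

lemma dirichlet_kernel_shift:
  assumes "0 \<le> p $ i"
  shows "dirichlet_kernel (\<beta> + axis i 1) p = p $ i * dirichlet_kernel \<beta> p"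
proof -
  have "dirichlet_kernel (\<beta> + axis i 1) p
      = (p $ i) powr (\<beta> $ i) * (\<Prod>l\<in>UNIV - {i}. (p $ l) powr ((\<beta> + axis i 1) $ l - 1))"
    unfolding dirichlet_kernel_def by (subst prod.remove[of _ i]) (auto simp: axis_def)
  also have "(\<Prod>l\<in>UNIV - {i}. (p $ l) powr ((\<beta> + axis i 1) $ l - 1))
      = (\<Prod>l\<in>UNIV - {i}. (p $ l) powr (\<beta> $ l - 1))"
    by (rule prod.cong) (auto simp: axis_def)
  also have "(p $ i) powr (\<beta> $ i) = p $ i * (p $ i) powr (\<beta> $ i - 1)"
    using assms by (simp add: powr_mult_base)
  finally show ?thesis
    unfolding dirichlet_kernel_def by (subst prod.remove[of UNIV i]) auto
qed

lemma sum_axis_shift: "(\<Sum>l\<in>UNIV. ((\<beta> :: real ^ 'k::finite) + axis i 1) $ l) = (\<Sum>l\<in>UNIV. \<beta> $ l) + 1"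
  unfolding vector_add_component sum.distrib by (simp add: axis_def)

lemma integrable_dirichlet_kernel_shift:
  assumes "integrable simplex_lebesgue (dirichlet_kernel \<beta>)"
  shows "integrable simplex_lebesgue (dirichlet_kernel (\<beta> + axis i 1))"
proof -
  have "integrable simplex_lebesgue (dirichlet_kernel (\<beta> + axis i 1)) \<longleftrightarrow>
      integrable simplex_lebesgue (\<lambda>p. p $ i * dirichlet_kernel \<beta> p)"
    by (rule Bochner_Integration.integrable_cong)
       (simp_all add: dirichlet_kernel_shift prob_simplex_nth)
  then show ?thesis
    using integrable_nth_mult_simplex[OF assms] by simp
qed

lemma integral_dirichlet_kernel_shift:
  "(\<integral>p. f p * dirichlet_kernel (\<beta> + axis i 1) p \<partial>simplex_lebesgue)
    = (\<integral>p. p $ i * (f p * dirichlet_kernel \<beta> p) \<partial>simplex_lebesgue)"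
  by (rule Bochner_Integration.integral_cong)
     (simp_all add: dirichlet_kernel_shift prob_simplex_nth)

section \<open>Mean, variance and concentration of Dirichlet distributions\<close>

definition dirichlet_mean :: "real ^ 'k::finite \<Rightarrow> real ^ 'k" where
  "dirichlet_mean \<beta> = (\<chi> i. \<beta> $ i / (\<Sum>l\<in>UNIV. \<beta> $ l))"

lemma dirichlet_mean_in_interior:
  fixes \<beta> :: "real ^ 'k::finite"
  assumes "\<And>l. 0 < \<beta> $ l"
  shows "dirichlet_mean \<beta> \<in> simplex_interior"
proof -
  have "0 < (\<Sum>l\<in>UNIV. \<beta> $ l)"
    using assms by (intro sum_pos) auto
  then show ?thesis
    using assms by (simp add: simplex_interior_def prob_simplex_def dirichlet_mean_def
        less_imp_le sum_divide_distrib [symmetric])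
qed

lemma norm_vec_squared: "(norm (v :: real ^ 'k::finite))\<^sup>2 = (\<Sum>i\<in>UNIV. (v $ i)\<^sup>2)"
  by (simp add: norm_vec_def L2_set_def sum_nonneg)

text \<open>A second moment is a first moment for the exponents raised by one at \<open>i\<close>,
  so each coordinate has an explicit variance, at most its mean divided by \<open>s\<close>. The
  means add up to 1, which removes any dependence on the number of sides.\<close>

lemma dirichlet_variance:
  fixes \<beta> :: "real ^ 'k::finite"
  assumes pos: "\<And>l. 0 < \<beta> $ l" and int: "integrable simplex_lebesgue (dirichlet_kernel \<beta>)"
  defines "s \<equiv> (\<Sum>l\<in>UNIV. \<beta> $ l)"
  shows "integrable simplex_lebesgue (\<lambda>p. (norm (p - dirichlet_mean \<beta>))\<^sup>2 * dirichlet_kernel \<beta> p)"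
    and "(\<integral>p. (norm (p - dirichlet_mean \<beta>))\<^sup>2 * dirichlet_kernel \<beta> p \<partial>simplex_lebesgue)
      \<le> (\<integral>p. dirichlet_kernel \<beta> p \<partial>simplex_lebesgue) / s"
proof -
  let ?h = "dirichlet_kernel \<beta>" and ?m = "dirichlet_mean \<beta>"
  let ?D = "\<integral>p. ?h p \<partial>simplex_lebesgue"
  have s: "0 < s" unfolding s_def using pos by (intro sum_pos) auto
  have D: "0 \<le> ?D" by simp
  note int1 = integrable_nth_mult_simplex[OF int]
  note int2 = integrable_nth_mult_simplex[OF int1]
  have expand: "(p $ i - ?m $ i)\<^sup>2 * ?h p
      = p $ i * (p $ i * ?h p) - 2 * ?m $ i * (p $ i * ?h p) + (?m $ i)\<^sup>2 * ?h p" for p i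
    by (simp add: power2_eq_square algebra_simps)
  have inti: "integrable simplex_lebesgue (\<lambda>p. (p $ i - ?m $ i)\<^sup>2 * ?h p)" for i
    unfolding expand using int1 int2 int by auto
  have vari: "(\<integral>p. (p $ i - ?m $ i)\<^sup>2 * ?h p \<partial>simplex_lebesgue) \<le> ?m $ i * (?D / s)" for i
  proof -
    have mom1: "(\<integral>p. p $ i * ?h p \<partial>simplex_lebesgue) = ?m $ i * ?D"
      using dirichlet_first_moment[OF pos int] by (simp add: dirichlet_mean_def)
    have pos': "\<And>l. 0 < (\<beta> + axis i 1) $ l"
      using pos by (simp add: axis_def add_pos_nonneg)
    have "(\<integral>p. p $ i * (p $ i * ?h p) \<partial>simplex_lebesgue)
        = (\<integral>p. p $ i * dirichlet_kernel (\<beta> + axis i 1) p \<partial>simplex_lebesgue)"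
      by (simp add: integral_dirichlet_kernel_shift)
    also have "\<dots> = (\<beta> $ i + 1) / (s + 1) * (\<integral>p. 1 * dirichlet_kernel (\<beta> + axis i 1) p \<partial>simplex_lebesgue)"
      using dirichlet_first_moment[OF pos' integrable_dirichlet_kernel_shift[OF int], of i]
      unfolding sum_axis_shift s_def by simp
    also have "\<dots> = (\<beta> $ i + 1) / (s + 1) * (?m $ i * ?D)"
      by (subst integral_dirichlet_kernel_shift) (simp add: mom1)
    finally have mom2: "(\<integral>p. p $ i * (p $ i * ?h p) \<partial>simplex_lebesgue)
        = (\<beta> $ i + 1) / (s + 1) * (?m $ i * ?D)" .
    have "(\<integral>p. (p $ i - ?m $ i)\<^sup>2 * ?h p \<partial>simplex_lebesgue)
        = (\<beta> $ i + 1) / (s + 1) * (?m $ i * ?D) - 2 * ?m $ i * (?m $ i * ?D) + (?m $ i)\<^sup>2 * ?D"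
      unfolding expand using int1 int2 int
      by (simp add: mom1 mom2)
    also have "\<dots> = ((\<beta> $ i + 1) / (s + 1) - ?m $ i) * (?m $ i * ?D)"
      by (simp add: power2_eq_square algebra_simps)
    also have "\<dots> \<le> (1 / s) * (?m $ i * ?D)"
    proof (rule mult_right_mono)
      \<comment> \<open>The exact difference is kept first; enlarging \<open>s - \<beta> $ i\<close>
        to \<open>s + 1\<close> then cancels one factor of the denominator.\<close>
      have "(\<beta> $ i + 1) / (s + 1) - ?m $ i = (s - \<beta> $ i) / (s * (s + 1))"
        using s by (simp add: dirichlet_mean_def s_def[symmetric] divide_simps) (simp add: algebra_simps)
      also have "\<dots> \<le> (s + 1) / (s * (s + 1))"
        using s pos[of i] by (intro divide_right_mono) auto
      also have "\<dots> = 1 / s" using s by simp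
      finally show "(\<beta> $ i + 1) / (s + 1) - ?m $ i \<le> 1 / s" .
      show "0 \<le> ?m $ i * ?D"
        using D s pos[of i] by (simp add: dirichlet_mean_def s_def [symmetric])
    qed
    finally show ?thesis by simp
  qed
  have eq: "(norm (p - ?m))\<^sup>2 * ?h p = (\<Sum>i\<in>UNIV. (p $ i - ?m $ i)\<^sup>2 * ?h p)" for p
    by (simp add: norm_vec_squared sum_distrib_right)
  show "integrable simplex_lebesgue (\<lambda>p. (norm (p - ?m))\<^sup>2 * ?h p)"
    unfolding eq using inti by auto
  have "(\<integral>p. (norm (p - ?m))\<^sup>2 * ?h p \<partial>simplex_lebesgue) \<le> (\<Sum>i\<in>UNIV. ?m $ i * (?D / s))"
    unfolding eq using inti by (subst Bochner_Integration.integral_sum) (use vari in \<open>auto intro!: sum_mono\<close>)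
  also have "\<dots> = ?D / s"
    unfolding sum_distrib_right [symmetric]
    using dirichlet_mean_in_interior[OF pos] by (simp add: simplex_interior_def prob_simplex_def)
  finally show "(\<integral>p. (norm (p - ?m))\<^sup>2 * ?h p \<partial>simplex_lebesgue) \<le> ?D / s" .
qed

lemma bounded_prob_simplex: "bounded (prob_simplex :: (real ^ 'k::finite) set)"
proof (rule boundedI)
  fix p :: "real ^ 'k" assume p: "p \<in> prob_simplex"
  have "norm p \<le> (\<Sum>i\<in>UNIV. \<bar>p $ i\<bar>)" by (rule norm_le_l1_cart)
  also have "\<dots> = 1" using prob_simplex_nth[OF p] by simp
  finally show "norm p \<le> 1" .
qed

text \<open>The difference of the means is the vector from the old mean to the vertex
  \<open>axis k 1\<close>, divided by the new total. Hence \<open>r\<close> takes almost the same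
  value at both means when the total is large.\<close>

lemma dirichlet_mean_shift:
  fixes \<beta> :: "real ^ 'k::finite"
  assumes pos: "\<And>l. 0 < \<beta> $ l"
  shows "dist (dirichlet_mean (\<beta> + axis k 1)) (dirichlet_mean \<beta>) \<le> 2 / (\<Sum>l\<in>UNIV. \<beta> $ l)"
proof -
  let ?s = "\<Sum>l\<in>UNIV. \<beta> $ l"
  have s: "0 < ?s" using pos by (intro sum_pos) auto
  have "dirichlet_mean (\<beta> + axis k 1) - dirichlet_mean \<beta> = (1 / (?s + 1)) *\<^sub>R (axis k 1 - dirichlet_mean \<beta>)"
    unfolding vec_eq_iff dirichlet_mean_def sum_axis_shift
    using s by (auto simp: divide_simps) (auto simp: algebra_simps)
  then have "dist (dirichlet_mean (\<beta> + axis k 1)) (dirichlet_mean \<beta>)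
      = 1 / (?s + 1) * norm (axis k 1 - dirichlet_mean \<beta>)"
    using s by (simp add: dist_norm)
  also have "\<dots> \<le> 1 / (?s + 1) * (norm (axis k 1 :: real ^ 'k) + norm (dirichlet_mean \<beta>))"
    using s by (intro mult_left_mono norm_triangle_ineq4) auto
  also have "\<dots> \<le> 1 / (?s + 1) * (1 + 1)"
  proof (intro mult_left_mono add_mono)
    have "norm (dirichlet_mean \<beta>) \<le> (\<Sum>i\<in>UNIV. \<bar>dirichlet_mean \<beta> $ i\<bar>)" by (rule norm_le_l1_cart)
    also have "\<dots> = 1"
      using prob_simplex_nth[OF subsetD[OF simplex_interior_subset dirichlet_mean_in_interior[OF pos]]] by simp
    finally show "norm (dirichlet_mean \<beta>) \<le> 1" .
  qed (use s in simp_all)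
  also have "1 / (?s + 1) * (1 + 1) \<le> 2 / ?s" using s by (simp add: field_simps)
  finally show ?thesis by simp
qed

text \<open>
  Near the mean the uniform continuity of \<open>r\<close> applies; at distance at least \<open>d\<close> from it, the
  difference is at most \<open>2 * C\<close>, which is dominated by \<open>2 * C / d\<^sup>2\<close> times the squared distance.
\<close>

lemma dirichlet_concentration:
  fixes r :: "real ^ 'k::finite \<Rightarrow> real"
  assumes card: "CARD('k) \<ge> 2"
    and meas: "r \<in> borel_measurable simplex_lebesgue"
    and uc: "uniformly_continuous_on simplex_interior r" and "0 < \<eta>"
  obtains S where "0 < S"
    and "\<And>\<beta>. (\<And>l. 0 < \<beta> $ l) \<Longrightarrow> integrable simplex_lebesgue (dirichlet_kernel \<beta>) \<Longrightarrow>
      S \<le> (\<Sum>l\<in>UNIV. \<beta> $ l) \<Longrightarrow>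
      \<bar>(\<integral>p. r p * dirichlet_kernel \<beta> p \<partial>simplex_lebesgue)
        - r (dirichlet_mean \<beta>) * (\<integral>p. dirichlet_kernel \<beta> p \<partial>simplex_lebesgue)\<bar>
      \<le> \<eta> * (\<integral>p. dirichlet_kernel \<beta> p \<partial>simplex_lebesgue)"
proof -
  \<comment> \<open>A uniformly continuous function on a bounded set is bounded, which supplies
    \<open>C\<close>.\<close>
  have "bounded (simplex_interior :: (real ^ 'k) set)"
    using bounded_subset[OF bounded_prob_simplex simplex_interior_subset] .
  then have "bounded (r ` simplex_interior)"
    using uc by (rule bounded_uniformly_continuous_image[rotated])
  then obtain C where C: "0 < C" "\<And>p. p \<in> simplex_interior \<Longrightarrow> \<bar>r p\<bar> \<le> C"
    unfolding bounded_pos by (auto simp: real_norm_def)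
  obtain d where d: "0 < d" "\<And>p m. p \<in> simplex_interior \<Longrightarrow> m \<in> simplex_interior \<Longrightarrow>
      dist p m < d \<Longrightarrow> dist (r p) (r m) < \<eta> / 2"
    using uc \<open>0 < \<eta>\<close> unfolding uniformly_continuous_on_def by (metis half_gt_zero)
  \<comment> \<open>Chosen so that the far contribution, at most \<open>2 * C / d\<^sup>2\<close>
    times the variance bound, is \<open>\<eta> / 2\<close> times the integral of the kernel.\<close>
  define S where "S = 4 * C / (d\<^sup>2 * \<eta>)"
  have "0 < S" unfolding S_def using C d \<open>0 < \<eta>\<close> by simp
  moreover have "\<bar>(\<integral>p. r p * dirichlet_kernel \<beta> p \<partial>simplex_lebesgue)
        - r (dirichlet_mean \<beta>) * (\<integral>p. dirichlet_kernel \<beta> p \<partial>simplex_lebesgue)\<bar>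
      \<le> \<eta> * (\<integral>p. dirichlet_kernel \<beta> p \<partial>simplex_lebesgue)"
    if pos: "\<And>l. 0 < \<beta> $ l" and int: "integrable simplex_lebesgue (dirichlet_kernel \<beta>)"
      and S: "S \<le> (\<Sum>l\<in>UNIV. \<beta> $ l)" for \<beta>
  proof -
    let ?h = "dirichlet_kernel \<beta>" and ?m = "dirichlet_mean \<beta>" and ?s = "\<Sum>l\<in>UNIV. \<beta> $ l"
    let ?D = "\<integral>p. ?h p \<partial>simplex_lebesgue"
    have D: "0 \<le> ?D" by simp
    have m: "?m \<in> simplex_interior" by (rule dirichlet_mean_in_interior[OF pos])
    note var = dirichlet_variance[OF pos int]
    have [measurable]: "?h \<in> borel_measurable simplex_lebesgue"
      by (rule borel_measurable_simplex_lebesgue) measurable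
    note meas [measurable]
    have intr: "integrable simplex_lebesgue (\<lambda>p. r p * ?h p)"
    proof (rule Bochner_Integration.integrable_bound)
      show "integrable simplex_lebesgue (\<lambda>p. C * ?h p)" using int by simp
      show "AE p in simplex_lebesgue. norm (r p * ?h p) \<le> norm (C * ?h p)"
        using AE_simplex_interior[OF card]
        by eventually_elim (use C in \<open>auto simp: abs_mult intro!: mult_right_mono\<close>)
    qed measurable
    have "\<bar>(\<integral>p. r p * ?h p \<partial>simplex_lebesgue) - r ?m * ?D\<bar>
        = \<bar>\<integral>p. (r p - r ?m) * ?h p \<partial>simplex_lebesgue\<bar>"
      using intr int by (simp add: left_diff_distrib)
    also have "\<dots> \<le> (\<integral>p. \<bar>(r p - r ?m) * ?h p\<bar> \<partial>simplex_lebesgue)"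
      by (rule integral_abs_bound)
    also have "\<dots> \<le> (\<integral>p. \<eta> / 2 * ?h p + 2 * C / d\<^sup>2 * ((norm (p - ?m))\<^sup>2 * ?h p) \<partial>simplex_lebesgue)"
    proof (rule integral_mono_AE)
      show "integrable simplex_lebesgue (\<lambda>p. \<bar>(r p - r ?m) * ?h p\<bar>)"
        unfolding left_diff_distrib using intr int by auto
      show "integrable simplex_lebesgue (\<lambda>p. \<eta> / 2 * ?h p + 2 * C / d\<^sup>2 * ((norm (p - ?m))\<^sup>2 * ?h p))"
        using int var(1) by auto
      show "AE p in simplex_lebesgue. \<bar>(r p - r ?m) * ?h p\<bar>
          \<le> \<eta> / 2 * ?h p + 2 * C / d\<^sup>2 * ((norm (p - ?m))\<^sup>2 * ?h p)"
        using AE_simplex_interior[OF card]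
      proof eventually_elim
        case (elim p)
        have "\<bar>r p - r ?m\<bar> \<le> \<eta> / 2 + 2 * C / d\<^sup>2 * (norm (p - ?m))\<^sup>2"
        proof (cases "dist p ?m < d")
          case True
          have "\<bar>r p - r ?m\<bar> < \<eta> / 2" using d(2)[OF elim m True] by (simp add: dist_real_def)
          moreover have "0 \<le> 2 * C / d\<^sup>2 * (norm (p - ?m))\<^sup>2" using C by simp
          ultimately show ?thesis by linarith
        next
          case False
          then have "d\<^sup>2 \<le> (norm (p - ?m))\<^sup>2"
            using d(1) by (intro power_mono) (auto simp: dist_norm)
          then have "1 \<le> (norm (p - ?m))\<^sup>2 / d\<^sup>2" using d(1) by simp
          then have "2 * C * 1 \<le> 2 * C * ((norm (p - ?m))\<^sup>2 / d\<^sup>2)"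
            using C by (intro mult_left_mono) auto
          moreover have "\<bar>r p - r ?m\<bar> \<le> 2 * C" using C(2)[OF elim] C(2)[OF m] by linarith
          ultimately show ?thesis using \<open>0 < \<eta>\<close> by simp
        qed
        then have "\<bar>r p - r ?m\<bar> * ?h p \<le> (\<eta> / 2 + 2 * C / d\<^sup>2 * (norm (p - ?m))\<^sup>2) * ?h p"
          by (rule mult_right_mono) simp
        then show ?case by (simp add: abs_mult distrib_right mult.assoc)
      qed
    qed
    also have "\<dots> = \<eta> / 2 * ?D + 2 * C / d\<^sup>2 * (\<integral>p. (norm (p - ?m))\<^sup>2 * ?h p \<partial>simplex_lebesgue)"
      using int var(1) by simp
    also have "\<dots> \<le> \<eta> / 2 * ?D + 2 * C / d\<^sup>2 * (?D / ?s)"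
      using var(2) C by (intro add_left_mono mult_left_mono) auto
    also have "2 * C / d\<^sup>2 * (?D / ?s) \<le> 2 * C / d\<^sup>2 * (?D / S)"
      using S \<open>0 < S\<close> C D by (intro mult_left_mono divide_left_mono) auto
    also have "2 * C / d\<^sup>2 * (?D / S) = \<eta> / 2 * ?D"
      using C d(1) \<open>0 < \<eta>\<close> by (simp add: S_def field_simps)
    finally show ?thesis by simp
  qed
  ultimately show thesis by (rule that)
qed

text \<open>Coordinates lie in [0, 1], so larger exponents give a smaller kernel on the
  interior.\<close>

lemma integrable_dirichlet_kernel_mono:
  fixes \<alpha> \<beta> :: "real ^ 'k::finite"
  assumes "integrable simplex_lebesgue (dirichlet_kernel \<alpha>)" and "\<And>l. \<alpha> $ l \<le> \<beta> $ l"
    and card: "CARD('k) \<ge> 2"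
  shows "integrable simplex_lebesgue (dirichlet_kernel \<beta>)"
proof (rule Bochner_Integration.integrable_bound[OF assms(1)])
  show "dirichlet_kernel \<beta> \<in> borel_measurable simplex_lebesgue"
    by (rule borel_measurable_simplex_lebesgue) measurable
  have "dirichlet_kernel \<beta> p \<le> dirichlet_kernel \<alpha> p" if "p \<in> simplex_interior" for p
    unfolding dirichlet_kernel_def
  proof (intro prod_mono conjI powr_mono')
    fix i show "0 \<le> p $ i" "p $ i \<le> 1" "\<alpha> $ i - 1 \<le> \<beta> $ i - 1"
      using that assms(2)[of i] simplex_interior_subset prob_simplex_nth by force+
  qed simp
  note le = this
  show "AE p in simplex_lebesgue. norm (dirichlet_kernel \<beta> p) \<le> norm (dirichlet_kernel \<alpha> p)"
    using AE_simplex_interior[OF card] by eventually_elim (simp add: le)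
qed

section \<open>Posterior means\<close>

text \<open>Fixes one choice of the witnesses in Condition P, so that the thresholds obtained below
  depend on them and on the accuracy but not on the counts.\<close>

locale condition_P_prior =
  fixes \<pi> :: "real ^ 'k::finite \<Rightarrow> real" and \<alpha> :: "real ^ 'k" and r :: "real ^ 'k \<Rightarrow> real" and m :: real
  assumes card: "CARD('k) \<ge> 2" and prior: "prior_density \<pi>"
    and alpha_pos: "\<And>l. 0 < \<alpha> $ l"
    and r_def: "r = (\<lambda>p. \<pi> p / dirichlet_kernel \<alpha> p)"
    and uc: "uniformly_continuous_on simplex_interior r"
    and m_pos: "0 < m" and m_le: "\<And>p. p \<in> simplex_interior \<Longrightarrow> m \<le> r p"
begin

definition posterior_exponent :: "('k \<Rightarrow> nat) \<Rightarrow> real ^ 'k" where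
  "posterior_exponent y = (\<chi> l. real (y l) + \<alpha> $ l)"

lemma pi_measurable [measurable]: "\<pi> \<in> borel_measurable simplex_lebesgue"
  using prior by (simp add: prior_density_def)

lemma r_measurable [measurable]: "r \<in> borel_measurable simplex_lebesgue"
proof -
  have [measurable]: "dirichlet_kernel \<alpha> \<in> borel_measurable simplex_lebesgue"
    by (rule borel_measurable_simplex_lebesgue) measurable
  show ?thesis unfolding r_def by measurable
qed

text \<open>On the interior \<open>m\<close> times the kernel is at most \<pi>, and \<pi> is
  integrable as a density: the lower bound in Condition P replaces a computation of the Dirichlet
  integral.\<close>

lemma integrable_alpha: "integrable simplex_lebesgue (dirichlet_kernel \<alpha>)"
proof -
  have "integrable simplex_lebesgue \<pi>"
    using prior by (intro integrableI_nonneg) (auto simp: prior_density_def)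
  then have "integrable simplex_lebesgue (\<lambda>p. \<pi> p / m)" by simp
  then show ?thesis
  proof (rule Bochner_Integration.integrable_bound)
    show "dirichlet_kernel \<alpha> \<in> borel_measurable simplex_lebesgue"
      by (rule borel_measurable_simplex_lebesgue) measurable
    show "AE p in simplex_lebesgue. norm (dirichlet_kernel \<alpha> p) \<le> norm (\<pi> p / m)"
      using AE_simplex_interior[OF card]
    proof eventually_elim
      case (elim p)
      have "m * dirichlet_kernel \<alpha> p \<le> \<pi> p"
        using m_le[OF elim] dirichlet_kernel_pos[OF elim, of \<alpha>] by (simp add: r_def field_simps)
      then show ?case
        using m_pos by (simp add: field_simps)
    qed
  qed
qed

text \<open>A zero integral would make the kernel vanish almost everywhere, although it is positive
  on the interior, which has full measure. The whole measure would then be null, contradicting that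
  \<pi> has integral 1.\<close>

lemma integral_dirichlet_kernel_pos:
  assumes "integrable simplex_lebesgue (dirichlet_kernel \<beta>)"
  shows "0 < (\<integral>p. dirichlet_kernel \<beta> p \<partial>(simplex_lebesgue :: (real ^ 'k) measure))"
proof (rule ccontr)
  assume "\<not> 0 < (\<integral>p. dirichlet_kernel \<beta> p \<partial>simplex_lebesgue)"
  then have "(\<integral>p. dirichlet_kernel \<beta> p \<partial>simplex_lebesgue) = 0"
    by (intro antisym) (simp_all add: Bochner_Integration.integral_nonneg)
  then have "AE p in simplex_lebesgue. dirichlet_kernel \<beta> p = 0"
    using assms by (subst (asm) integral_nonneg_eq_0_iff_AE) auto
  then have "AE p in simplex_lebesgue. ennreal (\<pi> p) = 0"
    using AE_simplex_interior[OF card]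
    by eventually_elim (metis dirichlet_kernel_pos less_irrefl)
  then have "(\<integral>\<^sup>+p. ennreal (\<pi> p) \<partial>simplex_lebesgue) = 0"
    by (subst nn_integral_0_iff_AE) auto
  then show False
    using prior by (simp add: prior_density_def)
qed

lemma posterior_exponent_pos: "0 < posterior_exponent y $ l"
  using alpha_pos[of l] by (simp add: posterior_exponent_def add_nonneg_pos)

lemma integrable_posterior_kernel: "integrable simplex_lebesgue (dirichlet_kernel (posterior_exponent y))"
  by (rule integrable_dirichlet_kernel_mono[OF integrable_alpha _ card]) (simp add: posterior_exponent_def)

text \<open>Conjugacy: the likelihood adds the counts to the exponents and leaves \<open>r\<close>
  unchanged. The interior is required because the kernel is 0 on the boundary, where dividing by it
  loses \<pi>.\<close>

lemma likelihood_eq: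
  assumes "p \<in> simplex_interior"
  shows "(\<Prod>i\<in>UNIV. (p $ i) ^ y i) * \<pi> p = r p * dirichlet_kernel (posterior_exponent y) p"
proof -
  have p: "0 < p $ i" for i using assms by (simp add: simplex_interior_def)
  have "dirichlet_kernel (posterior_exponent y) p = (\<Prod>i\<in>UNIV. (p $ i) ^ y i * (p $ i) powr (\<alpha> $ i - 1))"
    unfolding dirichlet_kernel_def
  proof (rule prod.cong)
    fix i
    have "(p $ i) powr (posterior_exponent y $ i - 1) = (p $ i) powr (real (y i) + (\<alpha> $ i - 1))"
      by (simp add: posterior_exponent_def algebra_simps)
    then show "(p $ i) powr (posterior_exponent y $ i - 1) = (p $ i) ^ y i * (p $ i) powr (\<alpha> $ i - 1)"
      using p[of i] by (simp only: powr_add powr_realpow)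
  qed simp
  also have "\<dots> = (\<Prod>i\<in>UNIV. (p $ i) ^ y i) * dirichlet_kernel \<alpha> p"
    by (simp add: prod.distrib dirichlet_kernel_def)
  finally show ?thesis
    using dirichlet_kernel_pos[OF assms, of \<alpha>] by (simp add: r_def)
qed

lemma posterior_mean_eq:
  "posterior_mean \<pi> y k =
    (\<integral>p. r p * dirichlet_kernel (posterior_exponent y + axis k 1) p \<partial>simplex_lebesgue) /
    (\<integral>p. r p * dirichlet_kernel (posterior_exponent y) p \<partial>simplex_lebesgue)"
proof -
  have [measurable]: "dirichlet_kernel \<beta> \<in> borel_measurable simplex_lebesgue"
    "(\<lambda>p. p $ i) \<in> borel_measurable simplex_lebesgue" for \<beta> :: "real ^ 'k" and i :: 'k
    by (rule borel_measurable_simplex_lebesgue, measurable)+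
  have "(\<integral>p. p $ k * (\<Prod>i\<in>UNIV. (p $ i) ^ y i) * \<pi> p \<partial>simplex_lebesgue)
      = (\<integral>p. p $ k * (r p * dirichlet_kernel (posterior_exponent y) p) \<partial>simplex_lebesgue)"
  proof (rule integral_cong_AE)
    show "AE p in simplex_lebesgue. p $ k * (\<Prod>i\<in>UNIV. (p $ i) ^ y i) * \<pi> p
        = p $ k * (r p * dirichlet_kernel (posterior_exponent y) p)"
      using AE_simplex_interior[OF card]
      by eventually_elim (simp only: mult.assoc likelihood_eq)
  qed measurable
  moreover have "(\<integral>p. (\<Prod>i\<in>UNIV. (p $ i) ^ y i) * \<pi> p \<partial>simplex_lebesgue)
      = (\<integral>p. r p * dirichlet_kernel (posterior_exponent y) p \<partial>simplex_lebesgue)"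
  proof (rule integral_cong_AE)
    show "AE p in simplex_lebesgue. (\<Prod>i\<in>UNIV. (p $ i) ^ y i) * \<pi> p = r p * dirichlet_kernel (posterior_exponent y) p"
      using AE_simplex_interior[OF card]
      by eventually_elim (simp only: likelihood_eq)
  qed measurable
  ultimately show ?thesis
    unfolding posterior_mean_def integral_dirichlet_kernel_shift by simp
qed

text \<open>The error must be relative, since \<open>posterior_exponent y $ k\<close> divided by the
  total can be arbitrarily small. This works because the shifted kernel has integral
  \<open>u * D\<close>: its concentration error is already proportional to \<open>u\<close>, and
  \<open>u\<close> survives in the quotient.\<close>

lemma posterior_mean_relative_error:
  assumes "0 < \<kappa>"
  obtains N where "0 < N"
    and "\<And>y k. N \<le> (\<Sum>l\<in>UNIV. real (y l)) \<Longrightarrow>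
      \<bar>posterior_mean \<pi> y k - posterior_exponent y $ k / (\<Sum>l\<in>UNIV. posterior_exponent y $ l)\<bar>
        \<le> \<kappa> * (posterior_exponent y $ k / (\<Sum>l\<in>UNIV. posterior_exponent y $ l))"
proof -
  \<comment> \<open>The bound \<open>m / 2\<close> keeps the denominator at least
    \<open>m / 2 * D\<close>; the bound \<open>m * \<kappa> / 6\<close> makes the three errors of
    size \<open>\<eta> * (u * D)\<close> collected below fit into \<open>\<kappa> * u\<close> times
    it.\<close>
  define \<eta> where "\<eta> = min (m * \<kappa> / 6) (m / 2)"
  have \<eta>: "0 < \<eta>" "\<eta> \<le> m / 2" "\<eta> \<le> m * \<kappa> / 6"
    using m_pos \<open>0 < \<kappa>\<close> by (auto simp: \<eta>_def)
  obtain S where S: "0 < S" "\<And>\<beta>. (\<And>l. 0 < \<beta> $ l) \<Longrightarrow> integrable simplex_lebesgue (dirichlet_kernel \<beta>) \<Longrightarrow>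
      S \<le> (\<Sum>l\<in>UNIV. \<beta> $ l) \<Longrightarrow>
      \<bar>(\<integral>p. r p * dirichlet_kernel \<beta> p \<partial>simplex_lebesgue)
        - r (dirichlet_mean \<beta>) * (\<integral>p. dirichlet_kernel \<beta> p \<partial>simplex_lebesgue)\<bar>
      \<le> \<eta> * (\<integral>p. dirichlet_kernel \<beta> p \<partial>simplex_lebesgue)"
    using dirichlet_concentration[OF card r_measurable uc \<eta>(1)] by blast
  obtain d where d: "0 < d" "\<And>p p'. p \<in> simplex_interior \<Longrightarrow> p' \<in> simplex_interior \<Longrightarrow>
      dist p p' < d \<Longrightarrow> dist (r p) (r p') < \<eta>"
    using uc \<eta>(1) unfolding uniformly_continuous_on_def by metis
  \<comment> \<open>The added 1 makes \<open>2 / d < s\<close> strict, so the shift of the mean is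
    shorter than \<open>d\<close>.\<close>
  define N where "N = max S (2 / d + 1)"
  have "0 < N" using S(1) by (simp add: N_def)
  moreover have "\<bar>posterior_mean \<pi> y k - posterior_exponent y $ k / (\<Sum>l\<in>UNIV. posterior_exponent y $ l)\<bar>
        \<le> \<kappa> * (posterior_exponent y $ k / (\<Sum>l\<in>UNIV. posterior_exponent y $ l))"
    if y: "N \<le> (\<Sum>l\<in>UNIV. real (y l))" for y k
  proof -
    let ?\<beta> = "posterior_exponent y" and ?\<beta>' = "posterior_exponent y + axis k 1"
    define s where "s = (\<Sum>l\<in>UNIV. posterior_exponent y $ l)"
    define D where "D = (\<integral>p. dirichlet_kernel ?\<beta> p \<partial>simplex_lebesgue)"
    define a where "a = (\<integral>p. r p * dirichlet_kernel ?\<beta>' p \<partial>simplex_lebesgue)"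
    define b where "b = (\<integral>p. r p * dirichlet_kernel ?\<beta> p \<partial>simplex_lebesgue)"
    define u where "u = ?\<beta> $ k / s"
    define \<rho> where "\<rho> = r (dirichlet_mean ?\<beta>)"
    have "(\<Sum>l\<in>UNIV. real (y l)) \<le> s"
      unfolding s_def using alpha_pos by (intro sum_mono) (simp add: posterior_exponent_def less_imp_le)
    with y have sN: "S \<le> s" "2 / d < s" by (auto simp: N_def)
    have s: "0 < s" using sN(1) S(1) by linarith
    have pos': "\<And>l. 0 < ?\<beta>' $ l" using posterior_exponent_pos[of y] by (simp add: axis_def add_pos_nonneg)
    have int': "integrable simplex_lebesgue (dirichlet_kernel ?\<beta>')"
      by (rule integrable_dirichlet_kernel_shift[OF integrable_posterior_kernel])
    have D: "0 < D" unfolding D_def by (rule integral_dirichlet_kernel_pos[OF integrable_posterior_kernel])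
    have u: "0 < u" unfolding u_def using posterior_exponent_pos s by simp
    have D': "(\<integral>p. dirichlet_kernel ?\<beta>' p \<partial>simplex_lebesgue) = u * D"
      using integral_dirichlet_kernel_shift[of "\<lambda>_. 1" ?\<beta> k] dirichlet_first_moment[OF posterior_exponent_pos integrable_posterior_kernel, of k]
      by (simp add: u_def D_def s_def)
    have b: "\<bar>b - \<rho> * D\<bar> \<le> \<eta> * D"
      using S(2)[OF posterior_exponent_pos integrable_posterior_kernel] sN(1) by (simp add: b_def \<rho>_def D_def s_def)
    have "\<bar>a - r (dirichlet_mean ?\<beta>') * (u * D)\<bar> \<le> \<eta> * (u * D)"
      using S(2)[OF pos' int'] sN(1) unfolding sum_axis_shift s_def [symmetric] a_def D' by simp
    moreover have "\<bar>r (dirichlet_mean ?\<beta>') - \<rho>\<bar> \<le> \<eta>"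
    proof -
      have "dist (dirichlet_mean ?\<beta>') (dirichlet_mean ?\<beta>) \<le> 2 / s"
        unfolding s_def by (rule dirichlet_mean_shift[OF posterior_exponent_pos])
      also have "\<dots> < d" using sN(2) s d(1) by (simp add: field_simps)
      finally show ?thesis
        using d(2)[OF dirichlet_mean_in_interior[OF pos'] dirichlet_mean_in_interior[OF posterior_exponent_pos]]
        unfolding \<rho>_def dist_real_def by (simp add: less_imp_le)
    qed
    then have "\<bar>r (dirichlet_mean ?\<beta>') - \<rho>\<bar> * (u * D) \<le> \<eta> * (u * D)"
      using u D by (intro mult_right_mono) auto
    then have "\<bar>r (dirichlet_mean ?\<beta>') * (u * D) - \<rho> * (u * D)\<bar> \<le> \<eta> * (u * D)"
      using u D by (simp add: left_diff_distrib [symmetric] abs_mult)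
    \<comment> \<open>One error comes from concentration for the shifted exponents, the other from
      replacing \<open>r\<close> at the shifted mean by \<open>\<rho>\<close>. The third, below,
      comes from the denominator.\<close>
    ultimately have a: "\<bar>a - \<rho> * (u * D)\<bar> \<le> 2 * \<eta> * (u * D)"
      by linarith
    have \<rho>: "m \<le> \<rho>"
      unfolding \<rho>_def by (rule m_le[OF dirichlet_mean_in_interior[OF posterior_exponent_pos]])
    have "m / 2 * D \<le> (\<rho> - \<eta>) * D"
      using \<rho> \<eta> D by (intro mult_right_mono) auto
    also have "\<dots> \<le> b" using b by (simp add: left_diff_distrib)
    finally have b_ge: "m / 2 * D \<le> b" .
    then have b_pos: "0 < b" using m_pos D by (meson half_gt_zero mult_pos_pos less_le_trans)
    have "u * \<bar>b - \<rho> * D\<bar> \<le> u * (\<eta> * D)" using b u by (intro mult_left_mono) auto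
    then have "\<bar>u * b - \<rho> * (u * D)\<bar> \<le> \<eta> * (u * D)"
    proof -
      have "u * b - \<rho> * (u * D) = u * (b - \<rho> * D)" by (simp add: algebra_simps)
      then have "\<bar>u * b - \<rho> * (u * D)\<bar> = u * \<bar>b - \<rho> * D\<bar>"
        using u by (simp add: abs_mult)
      then show ?thesis using \<open>u * \<bar>b - \<rho> * D\<bar> \<le> u * (\<eta> * D)\<close> by (simp add: mult.left_commute)
    qed
    with a have "\<bar>a - u * b\<bar> \<le> 3 * \<eta> * (u * D)" by linarith
    also have "\<dots> \<le> 3 * (m * \<kappa> / 6) * (u * D)"
    proof (rule mult_right_mono)
      show "3 * \<eta> \<le> 3 * (m * \<kappa> / 6)" using \<eta>(3) by linarith
    qed (use u D in simp)
    also have "\<dots> = \<kappa> * u * (m / 2 * D)" by simp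
    also have "\<dots> \<le> \<kappa> * u * b" using b_ge u \<open>0 < \<kappa>\<close> by (intro mult_left_mono) auto
    finally have "\<bar>a - u * b\<bar> / b \<le> \<kappa> * u" using b_pos by (simp add: field_simps)
    moreover have "\<bar>a / b - u\<bar> = \<bar>a - u * b\<bar> / b"
      using b_pos by (simp add: field_simps)
    ultimately have "\<bar>a / b - u\<bar> \<le> \<kappa> * u" by simp
    then show ?thesis
      unfolding posterior_mean_eq a_def b_def u_def s_def .
  qed
  ultimately show thesis by (rule that)
qed

end

text \<open>Passes from exponents to raw counts: the lower bound drops the prior mass, the upper
  bound adds all of it to the count. The constant \<open>a\<close> is fixed before the accuracy
  \<kappa>, so it can later be compared with \<open>n * p $ k\<close>.\<close>

lemma posterior_mean_bounds:
  fixes \<pi> :: "real ^ 'k::finite \<Rightarrow> real"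
  assumes "CARD('k) \<ge> 2" "prior_density \<pi>" "condition_P \<pi>"
  obtains a where "0 < a" and "\<And>\<kappa>. 0 < \<kappa> \<Longrightarrow> \<kappa> < 1 \<Longrightarrow>
    \<exists>N>0. \<forall>y k n. n = (\<Sum>l\<in>UNIV. real (y l)) \<longrightarrow> N \<le> n \<longrightarrow>
      (1 - \<kappa>) * (real (y k) / n) \<le> posterior_mean \<pi> y k \<and>
      posterior_mean \<pi> y k \<le> (1 + \<kappa>) * ((real (y k) + a) / n)"
proof -
  obtain \<alpha> m where \<alpha>: "\<And>l. 0 < \<alpha> $ l"
    "uniformly_continuous_on simplex_interior (\<lambda>p. \<pi> p / dirichlet_kernel \<alpha> p)"
    "0 < m" "\<And>p. p \<in> simplex_interior \<Longrightarrow> m \<le> \<pi> p / dirichlet_kernel \<alpha> p"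
    using assms(3) unfolding condition_P_def condition_P_exp_def Let_def dirichlet_kernel_def [symmetric]
    by blast
  interpret condition_P_prior \<pi> \<alpha> "\<lambda>p. \<pi> p / dirichlet_kernel \<alpha> p" m
    by unfold_locales (use assms \<alpha> in auto)
  define a where "a = (\<Sum>l\<in>UNIV. \<alpha> $ l)"
  have "0 < a" unfolding a_def using \<alpha>(1) by (intro sum_pos) auto
  moreover have "\<exists>N>0. \<forall>y k n. n = (\<Sum>l\<in>UNIV. real (y l)) \<longrightarrow> N \<le> n \<longrightarrow>
      (1 - \<kappa>) * (real (y k) / n) \<le> posterior_mean \<pi> y k \<and>
      posterior_mean \<pi> y k \<le> (1 + \<kappa>) * ((real (y k) + a) / n)" if \<kappa>: "0 < \<kappa>" "\<kappa> < 1" for \<kappa>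
  proof -
    obtain N where N: "0 < N" "\<And>y k. N \<le> (\<Sum>l\<in>UNIV. real (y l)) \<Longrightarrow>
      \<bar>posterior_mean \<pi> y k - posterior_exponent y $ k / (\<Sum>l\<in>UNIV. posterior_exponent y $ l)\<bar>
        \<le> \<kappa> / 2 * (posterior_exponent y $ k / (\<Sum>l\<in>UNIV. posterior_exponent y $ l))"
      using posterior_mean_relative_error[of "\<kappa> / 2"] \<kappa> by auto
    \<comment> \<open>The second threshold gives \<open>a \<le> \<kappa> / 2 * n\<close>, so
      replacing \<open>n + a\<close> by \<open>n\<close> costs a factor
      \<open>1 - \<kappa> / 2\<close>. A second such factor comes from the posterior mean, and their
      product is at least \<open>1 - \<kappa>\<close>.\<close>
    show ?thesis
    proof (intro exI[of _ "max N (2 * a / \<kappa>)"] conjI allI impI)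
      show "0 < max N (2 * a / \<kappa>)" using N(1) by simp
      fix y :: "'k \<Rightarrow> nat" and k n
      assume n: "n = (\<Sum>l\<in>UNIV. real (y l))" "max N (2 * a / \<kappa>) \<le> n"
      then have nN: "N \<le> n" "2 * a / \<kappa> \<le> n" by auto
      then have "0 < n" using N(1) by linarith
      define t where "t = posterior_exponent y $ k / (\<Sum>l\<in>UNIV. posterior_exponent y $ l)"
      have t: "t = (real (y k) + \<alpha> $ k) / (n + a)"
        by (simp add: t_def posterior_exponent_def sum.distrib n(1) a_def)
      have err: "\<bar>posterior_mean \<pi> y k - t\<bar> \<le> \<kappa> / 2 * t"
        using N(2)[of y k] nN(1) n(1) by (simp add: t_def)
      have "0 \<le> t" unfolding t using \<alpha>(1)[of k] \<open>0 < n\<close> \<open>0 < a\<close> by (simp add: less_imp_le)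
      have "\<alpha> $ k \<le> a" unfolding a_def using \<alpha>(1) by (intro member_le_sum) (auto simp: less_imp_le)
      then have "t \<le> (real (y k) + a) / n"
        unfolding t using \<open>0 < n\<close> \<open>0 < a\<close> \<alpha>(1)[of k] by (intro frac_le) auto
      then have "(1 + \<kappa> / 2) * t \<le> (1 + \<kappa>) * ((real (y k) + a) / n)"
        using \<kappa> \<open>0 \<le> t\<close> by (intro mult_mono) auto
      then show "posterior_mean \<pi> y k \<le> (1 + \<kappa>) * ((real (y k) + a) / n)"
        using err unfolding abs_le_iff distrib_right[of 1 "\<kappa> / 2" t] by linarith
      have "a \<le> \<kappa> / 2 * n" using nN(2) \<kappa> by (simp add: field_simps)
      moreover have "0 \<le> \<kappa> / 2 * a" using \<kappa> \<open>0 < a\<close> by simp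
      ultimately have "(1 - \<kappa> / 2) * (n + a) \<le> n" by (simp add: algebra_simps)
      then have "(1 - \<kappa> / 2) / n \<le> 1 / (n + a)"
        using \<open>0 < n\<close> \<open>0 < a\<close> by (simp add: field_simps)
      then have "(1 - \<kappa> / 2) / n * real (y k) \<le> 1 / (n + a) * (real (y k) + \<alpha> $ k)"
        using \<alpha>(1)[of k] \<open>0 < n\<close> \<open>0 < a\<close> \<kappa> by (intro mult_mono) auto
      then have "(1 - \<kappa> / 2) * (real (y k) / n) \<le> t" unfolding t by simp
      then have "(1 - \<kappa> / 2) * ((1 - \<kappa> / 2) * (real (y k) / n)) \<le> (1 - \<kappa> / 2) * t"
        using \<kappa> by (intro mult_left_mono) auto
      moreover have "(1 - \<kappa>) * (real (y k) / n) \<le> ((1 - \<kappa> / 2) * (1 - \<kappa> / 2)) * (real (y k) / n)"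
        using \<open>0 < n\<close> by (intro mult_right_mono) (auto simp: field_simps)
      moreover have "(1 - \<kappa> / 2) * t \<le> posterior_mean \<pi> y k"
        using err unfolding abs_le_iff left_diff_distrib[of 1 "\<kappa> / 2" t] by linarith
      ultimately show "(1 - \<kappa>) * (real (y k) / n) \<le> posterior_mean \<pi> y k" by simp
    qed
  qed
  ultimately show thesis by (rule that)
qed

section \<open>Counts in the tossing process\<close>

lemma UNIV_die: "(UNIV :: die set) = {Blue, Red}"
  by (auto intro: die.exhaust)

lemma finite_observations: "finite (PiE {1..n} (\<lambda>_. UNIV) :: (nat \<Rightarrow> die \<times> 'k::finite) set)"
  by (intro finite_PiE) (simp_all add: UNIV_die flip: UNIV_Times_UNIV)

lemma card_eq_sum_of_bool: "real (card {i\<in>A. Q i}) = (\<Sum>i\<in>A. of_bool (Q i))" if "finite A"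
proof -
  have "(\<Sum>i\<in>A. of_bool (Q i)) = (\<Sum>i\<in>A. if Q i then 1 else 0 :: real)"
    by (intro sum.cong) auto
  also have "\<dots> = real (card {i\<in>A. Q i})"
    using that by (subst sum.inter_filter [symmetric]) auto
  finally show ?thesis by simp
qed

text \<open>Computed from the observation, unlike \<open>blue_count\<close>, so that every count
  used below is a function of \<open>obs n\<close>.\<close>

definition die_count :: "die \<Rightarrow> nat \<Rightarrow> (nat \<Rightarrow> die \<times> 'k) \<Rightarrow> nat" where
  "die_count d n x = card {i\<in>{1..n}. fst (x i) = d}"

lemma sum_side_count: "(\<Sum>k\<in>UNIV. side_count d n x k) = die_count d n (x :: nat \<Rightarrow> die \<times> 'k::finite)"
proof -
  have "{i\<in>{1..n}. fst (x i) = d} = (\<Union>k. {i\<in>{1..n}. x i = (d, k)})"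
    by (auto simp: prod_eq_iff)
  also have "card \<dots> = (\<Sum>k\<in>UNIV. card {i\<in>{1..n}. x i = (d, k)})"
    by (intro card_UN_disjoint) auto
  finally show ?thesis
    by (simp add: die_count_def side_count_def)
qed

lemma die_count_add: "die_count Blue n x + die_count Red n x = n"
proof -
  have "{i\<in>{1..n}. fst (x i) = Blue} \<union> {i\<in>{1..n}. fst (x i) = Red} = {1..n}"
  proof -
    have "fst (x i) = Blue \<or> fst (x i) = Red" for i
      by (cases "fst (x i)") auto
    then show ?thesis by auto
  qed
  then have "card ({i\<in>{1..n}. fst (x i) = Blue} \<union> {i\<in>{1..n}. fst (x i) = Red}) = n"
    by simp
  then show ?thesis
    unfolding die_count_def by (subst (asm) card_Un_disjoint) auto
qed

section \<open>Expectations involving the past and the next toss\<close>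

context dice_process
begin

abbreviation obs :: "nat \<Rightarrow> 'w \<Rightarrow> nat \<Rightarrow> die \<times> 'k" where
  "obs n \<equiv> observation die side n"

abbreviation param :: "die \<Rightarrow> 'k \<Rightarrow> real" where
  "param d k \<equiv> (case d of Blue \<Rightarrow> p $ k | Red \<Rightarrow> q $ k)"

text \<open>Independence of two families includes that their members are events, so this is read off
  from \<open>die_indep\<close>.\<close>

lemma obs_measurable [measurable]: "obs n \<in> measurable M (count_space UNIV)"
proof (rule measurableI)
  fix A :: "(nat \<Rightarrow> die \<times> 'k) set"
  show "obs n -` A \<inter> space M \<in> sets M"
    using indep_setD_ev1[OF die_indep[of n]] by auto
qed simp

lemma die_Suc_measurable [measurable]: "die (Suc n) \<in> measurable M (count_space UNIV)"
  by (rule die_measurable) simp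

lemma side_Suc_measurable [measurable]: "side (Suc n) \<in> measurable M (count_space UNIV)"
  by (rule side_measurable) simp

lemma obs_in_PiE: "obs n \<omega> \<in> PiE {1..n} (\<lambda>_. UNIV)"
  by (auto simp: observation_def)

lemma borel_measurable_obs [measurable]: "(\<lambda>\<omega>. g (obs n \<omega>) :: real) \<in> borel_measurable M"
  by (rule measurable_compose[OF obs_measurable]) simp

text \<open>An observation takes finitely many values, so any real function of it is
  bounded.\<close>

lemma integrable_obs: "integrable M (\<lambda>\<omega>. g (obs n \<omega>) :: real)"
proof (rule integrable_const_bound)
  let ?F = "PiE {1..n} (\<lambda>_. UNIV) :: (nat \<Rightarrow> die \<times> 'k) set"
  show "AE \<omega> in M. norm (g (obs n \<omega>)) \<le> (\<Sum>x\<in>?F. \<bar>g x\<bar>)"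
    using member_le_sum[OF obs_in_PiE _ finite_observations, where f = "\<lambda>x. \<bar>g x\<bar>"]
    by (intro AE_I2) (simp del: One_nat_def)
qed measurable

lemma integrable_obs_indicator:
  assumes [measurable]: "Measurable.pred M Q"
  shows "integrable M (\<lambda>\<omega>. g (obs n \<omega>) * of_bool (Q \<omega>) :: real)"
  by (rule Bochner_Integration.integrable_bound[OF integrable_obs[of g n]]) (auto simp: of_bool_def)

lemma expectation_of_bool:
  assumes [measurable]: "Measurable.pred M Q"
  shows "expectation (\<lambda>\<omega>. of_bool (Q \<omega>)) = \<P>(\<omega> in M. Q \<omega>)"
proof -
  have "expectation (\<lambda>\<omega>. of_bool (Q \<omega>)) = expectation (indicator {\<omega>\<in>space M. Q \<omega>})"
    by (intro Bochner_Integration.integral_cong) (auto simp: indicator_def)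
  also have "\<dots> = \<P>(\<omega> in M. Q \<omega>)"
    by (subst Bochner_Integration.integral_indicator) (simp_all add: Int_absorb1)
  finally show ?thesis .
qed

text \<open>Splitting by the value of the observation reduces expectations to the elementary
  probabilities that the axioms of \<open>dice_process\<close> prescribe.\<close>

lemma expectation_obs_indicator:
  assumes Q [measurable]: "Measurable.pred M Q"
  shows "expectation (\<lambda>\<omega>. g (obs n \<omega>) * of_bool (Q \<omega>)) =
    (\<Sum>x\<in>PiE {1..n} (\<lambda>_. UNIV). g x * \<P>(\<omega> in M. obs n \<omega> = x \<and> Q \<omega>))"
proof -
  let ?F = "PiE {1..n} (\<lambda>_. UNIV) :: (nat \<Rightarrow> die \<times> 'k) set"
  have eq: "g (obs n \<omega>) * of_bool (Q \<omega>) = (\<Sum>x\<in>?F. g x * of_bool (obs n \<omega> = x \<and> Q \<omega>))" for \<omega>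
  proof -
    have "(\<Sum>x\<in>?F. g x * of_bool (obs n \<omega> = x \<and> Q \<omega>))
        = (\<Sum>x\<in>?F. if x = obs n \<omega> then g x * of_bool (Q \<omega>) else 0)"
      by (intro sum.cong) auto
    also have "\<dots> = g (obs n \<omega>) * of_bool (Q \<omega>)"
      by (subst sum.delta[OF finite_observations]) (simp only: obs_in_PiE if_True)
    finally show ?thesis ..
  qed
  have [measurable]: "Measurable.pred M (\<lambda>\<omega>. obs n \<omega> = x \<and> Q \<omega>)" for x
    by measurable
  have "integrable M (\<lambda>\<omega>. g x * of_bool (obs n \<omega> = x \<and> Q \<omega>))" for x
    by (intro integrable_mult_right integrable_const_bound[where B = 1]) (auto simp: of_bool_def)
  then show ?thesis
    unfolding eq by (simp add: expectation_of_bool)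
qed

lemma expectation_obs_die:
  "expectation (\<lambda>\<omega>. g (obs n \<omega>) * of_bool (die (Suc n) \<omega> = d))
    = expectation (\<lambda>\<omega>. g (obs n \<omega>)) * \<P>(\<omega> in M. die (Suc n) \<omega> = d)"
proof -
  have "\<P>(\<omega> in M. obs n \<omega> = x \<and> die (Suc n) \<omega> = d) = \<P>(\<omega> in M. obs n \<omega> = x) * \<P>(\<omega> in M. die (Suc n) \<omega> = d)" for x
  proof -
    have "prob ((obs n -` {x} \<inter> space M) \<inter> (die (Suc n) -` {d} \<inter> space M))
        = prob (obs n -` {x} \<inter> space M) * prob (die (Suc n) -` {d} \<inter> space M)"
      by (rule indep_setD[OF die_indep[of n]]) blast+
    moreover have "(obs n -` {x} \<inter> space M) \<inter> (die (Suc n) -` {d} \<inter> space M)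
        = {\<omega>\<in>space M. obs n \<omega> = x \<and> die (Suc n) \<omega> = d}"
      "obs n -` {x} \<inter> space M = {\<omega>\<in>space M. obs n \<omega> = x}"
      "die (Suc n) -` {d} \<inter> space M = {\<omega>\<in>space M. die (Suc n) \<omega> = d}"
      by auto
    ultimately show ?thesis by simp
  qed
  moreover have "expectation (\<lambda>\<omega>. g (obs n \<omega>))
      = (\<Sum>x\<in>PiE {1..n} (\<lambda>_. UNIV). g x * \<P>(\<omega> in M. obs n \<omega> = x))"
    using expectation_obs_indicator[of "\<lambda>_. True" g n] by simp
  ultimately show ?thesis
    by (subst expectation_obs_indicator) (simp_all add: sum_distrib_right mult.assoc)
qed

text \<open>On each value of the past with positive probability this is the prescribed conditional
  probability; where the conditioning event has probability 0, both sides contribute 0.\<close>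

lemma expectation_obs_side:
  "expectation (\<lambda>\<omega>. g (obs n \<omega>) * of_bool (die (Suc n) \<omega> = d \<and> side (Suc n) \<omega> = k))
    = param d k * expectation (\<lambda>\<omega>. g (obs n \<omega>) * of_bool (die (Suc n) \<omega> = d))"
proof -
  have "\<P>(\<omega> in M. obs n \<omega> = x \<and> die (Suc n) \<omega> = d \<and> side (Suc n) \<omega> = k)
      = param d k * \<P>(\<omega> in M. obs n \<omega> = x \<and> die (Suc n) \<omega> = d)" for x
  proof (cases "\<P>(\<omega> in M. obs n \<omega> = x \<and> die (Suc n) \<omega> = d) > 0")
    case True
    then have "\<P>(\<omega> in M. side (Suc n) \<omega> = k \<bar> obs n \<omega> = x \<and> die (Suc n) \<omega> = d) = param d k"
      using blue_side[of n x k] red_side[of n x k] by (cases d) auto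
    then show ?thesis
      using True unfolding cond_prob_def by (simp add: field_simps conj_ac)
  next
    case False
    then have 0: "\<P>(\<omega> in M. obs n \<omega> = x \<and> die (Suc n) \<omega> = d) = 0"
      using measure_nonneg[of M "{\<omega>\<in>space M. obs n \<omega> = x \<and> die (Suc n) \<omega> = d}"] by linarith
    have "\<P>(\<omega> in M. obs n \<omega> = x \<and> die (Suc n) \<omega> = d \<and> side (Suc n) \<omega> = k)
        \<le> \<P>(\<omega> in M. obs n \<omega> = x \<and> die (Suc n) \<omega> = d)"
      by (intro finite_measure_mono) auto
    then have "\<P>(\<omega> in M. obs n \<omega> = x \<and> die (Suc n) \<omega> = d \<and> side (Suc n) \<omega> = k) = 0"
      using 0 measure_nonneg[of M "{\<omega>\<in>space M. obs n \<omega> = x \<and> die (Suc n) \<omega> = d \<and> side (Suc n) \<omega> = k}"] by linarith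
    then show ?thesis using 0 by simp
  qed
  then show ?thesis
    by (subst (1 2) expectation_obs_indicator) (simp_all add: sum_distrib_left mult_ac)
qed

section \<open>Sums of orthogonal increments and tail bounds for the counts\<close>

text \<open>The summand may depend on the period because the probability of choosing blue may vary
  with time.\<close>

definition partial_sum :: "(nat \<Rightarrow> die \<times> 'k \<Rightarrow> real) \<Rightarrow> nat \<Rightarrow> (nat \<Rightarrow> die \<times> 'k) \<Rightarrow> real" where
  "partial_sum f n x = (\<Sum>i=1..n. f i (x i))"

lemma partial_sum_obs_Suc:
  "partial_sum f (Suc n) (obs (Suc n) \<omega>) = partial_sum f n (obs n \<omega>) + f (Suc n) (die (Suc n) \<omega>, side (Suc n) \<omega>)"
  by (simp add: partial_sum_def observation_def)

text \<open>
  Each increment is orthogonal to every function of the past, so the cross terms vanish and the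
  second moments add up.
\<close>

lemma second_moment_partial_sum:
  assumes orth: "\<And>n g. expectation (\<lambda>\<omega>. g (obs n \<omega>) * f (Suc n) (die (Suc n) \<omega>, side (Suc n) \<omega>)) = 0"
    and var: "\<And>n. expectation (\<lambda>\<omega>. (f (Suc n) (die (Suc n) \<omega>, side (Suc n) \<omega>))\<^sup>2) \<le> v"
  shows "expectation (\<lambda>\<omega>. (partial_sum f n (obs n \<omega>))\<^sup>2) \<le> real n * v"
proof (induction n)
  case 0
  then show ?case by (simp add: partial_sum_def)
next
  case (Suc n)
  let ?S = "\<lambda>\<omega>. partial_sum f n (obs n \<omega>)" and ?\<xi> = "\<lambda>\<omega>. f (Suc n) (die (Suc n) \<omega>, side (Suc n) \<omega>)"
  have \<xi>: "?\<xi> \<omega> = f (Suc n) (obs (Suc n) \<omega> (Suc n))" for \<omega>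
    by (simp add: observation_def)
  \<comment> \<open>The earlier sum is also a function of the longer observation, so
    \<open>integrable_obs\<close> covers all three terms of the square.\<close>
  have S: "?S \<omega> = partial_sum f n (obs (Suc n) \<omega>)" for \<omega>
    unfolding partial_sum_def observation_def by (intro sum.cong) auto
  have int: "integrable M (\<lambda>\<omega>. (?S \<omega>)\<^sup>2)" "integrable M (\<lambda>\<omega>. ?S \<omega> * ?\<xi> \<omega>)" "integrable M (\<lambda>\<omega>. (?\<xi> \<omega>)\<^sup>2)"
    unfolding S \<xi> by (rule integrable_obs)+
  have "expectation (\<lambda>\<omega>. (partial_sum f (Suc n) (obs (Suc n) \<omega>))\<^sup>2)
      = expectation (\<lambda>\<omega>. (?S \<omega>)\<^sup>2 + 2 * (?S \<omega> * ?\<xi> \<omega>) + (?\<xi> \<omega>)\<^sup>2)"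
    unfolding partial_sum_obs_Suc by (simp add: power2_eq_square algebra_simps)
  also have "\<dots> = expectation (\<lambda>\<omega>. (?S \<omega>)\<^sup>2) + 2 * expectation (\<lambda>\<omega>. ?S \<omega> * ?\<xi> \<omega>) + expectation (\<lambda>\<omega>. (?\<xi> \<omega>)\<^sup>2)"
    using int by simp
  also have "\<dots> \<le> real n * v + 2 * 0 + v"
    using Suc.IH orth[of "partial_sum f n" n] var[of n] by (intro add_mono) simp_all
  finally show ?case by (simp add: algebra_simps)
qed

lemma partial_sum_tail:
  assumes "\<And>n g. expectation (\<lambda>\<omega>. g (obs n \<omega>) * f (Suc n) (die (Suc n) \<omega>, side (Suc n) \<omega>)) = 0"
    and "\<And>n. expectation (\<lambda>\<omega>. (f (Suc n) (die (Suc n) \<omega>, side (Suc n) \<omega>))\<^sup>2) \<le> v"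
    and "0 < t"
  shows "\<P>(\<omega> in M. t \<le> \<bar>partial_sum f n (obs n \<omega>)\<bar>) \<le> real n * v / t\<^sup>2"
proof -
  have "\<P>(\<omega> in M. t \<le> \<bar>partial_sum f n (obs n \<omega>)\<bar>)
      \<le> expectation (\<lambda>\<omega>. (partial_sum f n (obs n \<omega>))\<^sup>2) / t\<^sup>2"
    by (rule second_moment_method) (use \<open>0 < t\<close> in \<open>auto intro: integrable_obs\<close>)
  also have "\<dots> \<le> real n * v / t\<^sup>2"
    using assms by (intro divide_right_mono second_moment_partial_sum) auto
  finally show ?thesis .
qed

lemma expectation_die: "expectation (\<lambda>\<omega>. of_bool (die (Suc n) \<omega> = d)) = \<P>(\<omega> in M. die (Suc n) \<omega> = d)"
  by (rule expectation_of_bool) measurable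

lemma integrable_of_bool:
  assumes [measurable]: "Measurable.pred M Q"
  shows "integrable M (\<lambda>\<omega>. of_bool (Q \<omega>) :: real)"
  by (rule integrable_const_bound[where B = 1]) (auto simp: of_bool_def)

text \<open>The increments are the indicators of blue minus \<open>b i\<close>. They are orthogonal
  to the past because the choice of die is independent of it, and their squares are at most
  1.\<close>

lemma blue_count_tail:
  assumes "0 < t"
  shows "\<P>(\<omega> in M. t \<le> \<bar>real (die_count Blue n (obs n \<omega>)) - (\<Sum>i=1..n. b i)\<bar>) \<le> real n / t\<^sup>2"
proof -
  define f :: "nat \<Rightarrow> die \<times> 'k \<Rightarrow> real" where "f = (\<lambda>i x. of_bool (fst x = Blue) - b i)"
  have sum: "partial_sum f n x = real (die_count Blue n x) - (\<Sum>i=1..n. b i)" for x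
    unfolding partial_sum_def f_def die_count_def
    by (simp only: sum_subtractf card_eq_sum_of_bool finite_atLeastAtMost)
  have bP: "b (Suc m) = \<P>(\<omega> in M. die (Suc m) \<omega> = Blue)" for m
    by (simp add: die_prob)
  have "\<P>(\<omega> in M. t \<le> \<bar>partial_sum f n (obs n \<omega>)\<bar>) \<le> real n * 1 / t\<^sup>2"
  proof (rule partial_sum_tail[OF _ _ assms])
    fix m and g :: "(nat \<Rightarrow> die \<times> 'k) \<Rightarrow> real"
    have "expectation (\<lambda>\<omega>. g (obs m \<omega>) * f (Suc m) (die (Suc m) \<omega>, side (Suc m) \<omega>))
        = expectation (\<lambda>\<omega>. g (obs m \<omega>) * of_bool (die (Suc m) \<omega> = Blue) - b (Suc m) * g (obs m \<omega>))"
      by (intro Bochner_Integration.integral_cong) (simp_all add: f_def algebra_simps)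
    also have "\<dots> = expectation (\<lambda>\<omega>. g (obs m \<omega>) * of_bool (die (Suc m) \<omega> = Blue)) - b (Suc m) * expectation (\<lambda>\<omega>. g (obs m \<omega>))"
      using integrable_obs_indicator[of "\<lambda>\<omega>. die (Suc m) \<omega> = Blue" g m] integrable_obs[of g m]
      by (subst Bochner_Integration.integral_diff) auto
    also have "\<dots> = 0"
      unfolding expectation_obs_die by (simp add: bP)
    finally show "expectation (\<lambda>\<omega>. g (obs m \<omega>) * f (Suc m) (die (Suc m) \<omega>, side (Suc m) \<omega>)) = 0" .
    have b: "0 \<le> b (Suc m)" "b (Suc m) \<le> 1" unfolding bP by simp_all
    have bnd: "(f (Suc m) (die (Suc m) \<omega>, side (Suc m) \<omega>))\<^sup>2 \<le> 1" for \<omega>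
      using b by (auto simp: f_def of_bool_def abs_square_le_1)
    have "expectation (\<lambda>\<omega>. (f (Suc m) (die (Suc m) \<omega>, side (Suc m) \<omega>))\<^sup>2) \<le> expectation (\<lambda>\<omega>. 1)"
    proof (rule integral_mono)
      have "integrable M (\<lambda>\<omega>. (f (Suc m) (obs (Suc m) \<omega> (Suc m)))\<^sup>2)"
        by (rule integrable_obs)
      then show "integrable M (\<lambda>\<omega>. (f (Suc m) (die (Suc m) \<omega>, side (Suc m) \<omega>))\<^sup>2)"
        by (simp add: observation_def)
    qed (use bnd in simp_all)
    then show "expectation (\<lambda>\<omega>. (f (Suc m) (die (Suc m) \<omega>, side (Suc m) \<omega>))\<^sup>2) \<le> 1"
      by (simp add: prob_space)
  qed
  then show ?thesis by (simp add: sum)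
qed

text \<open>Centring by \<open>param d k\<close> times the number of tosses of die \<open>d\<close>,
  not by an expectation, makes the increments orthogonal to the past. Their second moment keeps the
  factor \<open>param d k\<close>; without it the bound would be useless when this probability is of
  order 1/n.\<close>

lemma side_count_tail:
  assumes "0 < t"
    and "0 \<le> param d k"
  shows "\<P>(\<omega> in M. t \<le> \<bar>real (side_count d n (obs n \<omega>) k) - param d k * real (die_count d n (obs n \<omega>))\<bar>)
    \<le> real n * param d k / t\<^sup>2"
proof -
  define f :: "nat \<Rightarrow> die \<times> 'k \<Rightarrow> real"
    where "f = (\<lambda>i x. of_bool (x = (d, k)) - param d k * of_bool (fst x = d))"
  have sum: "partial_sum f n x = real (side_count d n x k) - param d k * real (die_count d n x)" for x
    unfolding partial_sum_def f_def die_count_def side_count_def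
    by (simp only: sum_subtractf card_eq_sum_of_bool finite_atLeastAtMost sum_distrib_left)
  let ?D = "\<lambda>m \<omega>. die (Suc m) \<omega> = d" and ?K = "\<lambda>m \<omega>. die (Suc m) \<omega> = d \<and> side (Suc m) \<omega> = k"
  have [measurable]: "Measurable.pred M (?D m)" "Measurable.pred M (?K m)" for m
    by measurable
  have "\<P>(\<omega> in M. t \<le> \<bar>partial_sum f n (obs n \<omega>)\<bar>) \<le> real n * param d k / t\<^sup>2"
  proof (rule partial_sum_tail[OF _ _ assms(1)])
    fix m and g :: "(nat \<Rightarrow> die \<times> 'k) \<Rightarrow> real"
    have "expectation (\<lambda>\<omega>. g (obs m \<omega>) * f (Suc m) (die (Suc m) \<omega>, side (Suc m) \<omega>))
        = expectation (\<lambda>\<omega>. g (obs m \<omega>) * of_bool (?K m \<omega>) - param d k * (g (obs m \<omega>) * of_bool (?D m \<omega>)))"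
      by (intro Bochner_Integration.integral_cong) (simp_all add: f_def right_diff_distrib mult.left_commute)
    also have "\<dots> = expectation (\<lambda>\<omega>. g (obs m \<omega>) * of_bool (?K m \<omega>))
        - param d k * expectation (\<lambda>\<omega>. g (obs m \<omega>) * of_bool (?D m \<omega>))"
      using integrable_obs_indicator[of "?K m" g m] integrable_obs_indicator[of "?D m" g m]
      by (subst Bochner_Integration.integral_diff) auto
    also have "\<dots> = 0"
      unfolding expectation_obs_side by simp
    finally show "expectation (\<lambda>\<omega>. g (obs m \<omega>) * f (Suc m) (die (Suc m) \<omega>, side (Suc m) \<omega>)) = 0" .
    \<comment> \<open>The event with side \<open>k\<close> is contained in the event with die
      \<open>d\<close>, so the product of the two indicators is the first one.\<close>
    have "expectation (\<lambda>\<omega>. (f (Suc m) (die (Suc m) \<omega>, side (Suc m) \<omega>))\<^sup>2)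
        = expectation (\<lambda>\<omega>. (1 - 2 * param d k) * of_bool (?K m \<omega>) + (param d k)\<^sup>2 * of_bool (?D m \<omega>))"
      by (intro Bochner_Integration.integral_cong)
         (simp_all add: f_def of_bool_def power2_eq_square algebra_simps)
    also have "\<dots> = (1 - 2 * param d k) * expectation (\<lambda>\<omega>. of_bool (?K m \<omega>))
        + (param d k)\<^sup>2 * expectation (\<lambda>\<omega>. of_bool (?D m \<omega>))"
      by (subst Bochner_Integration.integral_add) (auto intro: integrable_of_bool)
    also have "expectation (\<lambda>\<omega>. of_bool (?K m \<omega>)) = param d k * \<P>(\<omega> in M. die (Suc m) \<omega> = d)"
      using expectation_obs_side[of "\<lambda>_. 1" m d k] by (simp add: expectation_die)
    also have "(1 - 2 * param d k) * (param d k * \<P>(\<omega> in M. die (Suc m) \<omega> = d))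
        + (param d k)\<^sup>2 * expectation (\<lambda>\<omega>. of_bool (?D m \<omega>))
        = (param d k - (param d k)\<^sup>2) * \<P>(\<omega> in M. die (Suc m) \<omega> = d)"
      unfolding expectation_die by (simp add: power2_eq_square algebra_simps)
    also have "\<dots> \<le> param d k * \<P>(\<omega> in M. die (Suc m) \<omega> = d)"
      by (intro mult_right_mono) auto
    also have "\<dots> \<le> param d k"
      using assms(2) by (intro mult_left_le) auto
    finally show "expectation (\<lambda>\<omega>. (f (Suc m) (die (Suc m) \<omega>, side (Suc m) \<omega>))\<^sup>2) \<le> param d k" .
  qed
  then show ?thesis by (simp only: sum)
qed

text \<open>The right side does not involve the parameter, so bounds on the mean blue count at one
  parameter hold at all of them.\<close>

lemma expectation_blue_count: "expectation (\<lambda>\<omega>. real (blue_count die n \<omega>)) = (\<Sum>i=1..n. b i)"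
proof -
  have "integrable M (\<lambda>\<omega>. of_bool (die i \<omega> = Blue) :: real)" if "i \<in> {1..n}" for i
    proof (rule integrable_of_bool)
    have [measurable]: "die i \<in> measurable M (count_space UNIV)"
      using die_measurable[of i] that by simp
    show "Measurable.pred M (\<lambda>\<omega>. die i \<omega> = Blue)" by measurable
  qed
  then have "expectation (\<lambda>\<omega>. real (blue_count die n \<omega>)) = (\<Sum>i=1..n. expectation (\<lambda>\<omega>. of_bool (die i \<omega> = Blue)))"
    unfolding blue_count_def card_eq_sum_of_bool[OF finite_atLeastAtMost]
    by (rule Bochner_Integration.integral_sum)
  also have "\<dots> = (\<Sum>i=1..n. b i)"
  proof (rule sum.cong)
    fix i assume i: "i \<in> {1..n}"
    have "expectation (\<lambda>\<omega>. of_bool (die i \<omega> = Blue)) = \<P>(\<omega> in M. die i \<omega> = Blue)"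
    proof (rule expectation_of_bool)
      have [measurable]: "die i \<in> measurable M (count_space UNIV)"
        using die_measurable[of i] i by simp
      show "Measurable.pred M (\<lambda>\<omega>. die i \<omega> = Blue)" by measurable
    qed
    then show "expectation (\<lambda>\<omega>. of_bool (die i \<omega> = Blue)) = b i"
      using i die_prob[of i] by simp
  qed simp
  finally show ?thesis .
qed

end

section \<open>Comparison of the two estimators\<close>

text \<open>The deterministic core. With \<delta> = 5t, the blue frequency is at least (1 - t) u,
  the red one with its prior mass, times c, is at most (1 + t) u, and \<eta> \<le> t; what is left
  is (1 - 5t)(1 + t)(1 + t) \<le> (1 - t)(1 - t).\<close>

lemma ratio_inequality:
  fixes a B R Y Z c \<delta> \<beta> \<eta> n u v :: real
  assumes "0 < c" "0 < \<delta>" "\<delta> < 1" "0 < \<beta>" "\<beta> \<le> 1" and \<eta>: "\<eta> = \<beta> * \<delta> / 20"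
    and n: "0 < n" and B: "\<beta> / 2 * n \<le> B" and R: "\<beta> / 2 * n \<le> R"
    and u: "0 < u" and v: "c * v \<le> u"
    and Y: "\<bar>Y - u * B\<bar> \<le> \<eta> * n * u" and Z: "\<bar>Z - v * R\<bar> \<le> \<eta> * n * u / c"
    and a: "a \<le> \<eta> * n * u / c"
  shows "c * (1 - \<delta>) * ((1 + \<eta>) * ((Z + a) / R)) \<le> (1 - \<eta>) * (Y / B)"
proof -
  define t where "t = \<delta> / 5"
  have t: "0 < t" "t < 1" "4 * \<eta> / \<beta> = t"
    using assms(2-4) by (auto simp: t_def \<eta>)
  have \<eta>0: "0 < \<eta>" using assms(2,4) by (simp add: \<eta>)
  have "\<eta> \<le> 1 * \<delta> / 20"
    unfolding \<eta> using assms(2,5) by (intro divide_right_mono mult_right_mono) auto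
  then have \<eta>t: "\<eta> \<le> t" using \<open>0 < \<delta>\<close> unfolding t_def by linarith
  have pos: "0 < \<beta> / 2 * n" using assms(4) n by simp
  then have B0: "0 < B" and R0: "0 < R" using B R by linarith+
  \<comment> \<open>With \<eta> = \<beta>\<delta>/20, an error of size \<open>\<eta> * n\<close>
    costs \<open>t / 2\<close> relative to \<open>B\<close> or \<open>R\<close>. The red side
    carries two such errors, from \<open>Z\<close> and from \<open>a\<close>, hence the
    halves.\<close>
  have step: "\<eta> * n \<le> t / 2 * x" if "\<beta> / 2 * n \<le> x" for x
  proof -
    have "\<eta> * n = t / 2 * (\<beta> / 2 * n)" unfolding \<eta> t_def by simp
    also have "\<dots> \<le> t / 2 * x" using that t by (intro mult_left_mono) auto
    finally show ?thesis .
  qed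
  have "u * B - t * (u * B) \<le> Y"
  proof -
    have "\<eta> * n * u \<le> t / 2 * B * u" using step[OF B] u by (intro mult_right_mono) auto
    moreover have "t / 2 * B * u \<le> t * (u * B)" using t u B0 by simp
    ultimately show ?thesis using Y by linarith
  qed
  then have YB: "(1 - t) * u \<le> Y / B"
    using B0 by (simp add: field_simps)
  have "c * (Z + a) \<le> (1 + t) * u * R"
  proof -
    have "\<eta> * n * u \<le> t / 2 * R * u" using step[OF R] u by (intro mult_right_mono) auto
    moreover have "Z + a \<le> v * R + 2 * (\<eta> * n * u / c)" using Z a by linarith
    then have "c * (Z + a) \<le> c * (v * R + 2 * (\<eta> * n * u / c))"
      using \<open>0 < c\<close> by (intro mult_left_mono) auto
    moreover have "c * (v * R + 2 * (\<eta> * n * u / c)) = c * v * R + 2 * (\<eta> * n * u)"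
      using \<open>0 < c\<close> by (simp add: field_simps)
    moreover have "c * v * R \<le> u * R" using v R0 by (intro mult_right_mono) auto
    moreover have "(1 + t) * u * R = u * R + 2 * (t / 2 * R * u)" by (simp add: algebra_simps)
    ultimately show ?thesis by linarith
  qed
  then have ZR: "c * ((Z + a) / R) \<le> (1 + t) * u"
    using R0 by (simp add: field_simps)
  have "c * (1 - \<delta>) * ((1 + \<eta>) * ((Z + a) / R)) = (1 - \<delta>) * (1 + \<eta>) * (c * ((Z + a) / R))"
    by simp
  also have "\<dots> \<le> (1 - \<delta>) * (1 + \<eta>) * ((1 + t) * u)"
    using ZR assms(3) \<eta>0 by (intro mult_left_mono) auto
  also have "\<dots> \<le> (1 - \<delta>) * (1 + t) * ((1 + t) * u)"
    using \<eta>t assms(3) t u by (intro mult_right_mono mult_left_mono) auto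
  also have "\<dots> = (1 - 5 * t) * (1 + t) * (1 + t) * u" by (simp add: t_def)
  also have "\<dots> \<le> (1 - t) * (1 - t) * u"
  proof (rule mult_right_mono)
    have "(1 - t) * (1 - t) - (1 - 5 * t) * (1 + t) * (1 + t) = t * (1 + 10 * t + 5 * t\<^sup>2)"
      by (simp add: power2_eq_square algebra_simps)
    also have "\<dots> \<ge> 0" using t by simp
    finally show "(1 - 5 * t) * (1 + t) * (1 + t) \<le> (1 - t) * (1 - t)" by simp
  qed (use u in simp)
  also have "\<dots> = (1 - t) * ((1 - t) * u)" by simp
  also have "\<dots> \<le> (1 - \<eta>) * (Y / B)"
    using YB \<eta>t t u by (intro mult_mono) auto
  finally show ?thesis .
qed

text \<open>A union bound over three Chebyshev events, with \<open>ratio_inequality\<close> outside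
  them; each event supplies one term of the constant.\<close>

lemma (in dice_process) estimator_ratio_probability:
  fixes k :: 'k
  assumes p: "p \<in> prob_simplex" and q: "q \<in> prob_simplex"
    and "0 < c" "0 < \<delta>" "\<delta> < 1" "0 < \<beta>" "\<beta> \<le> 1" and \<eta>: "\<eta> = \<beta> * \<delta> / 20" and "0 < a"
    and lower: "\<And>y k n. n = (\<Sum>l\<in>UNIV. real (y l)) \<Longrightarrow> N1 \<le> n \<Longrightarrow>
      (1 - \<eta>) * (real (y k) / n) \<le> posterior_mean \<pi> y k"
    and upper: "\<And>y k n. n = (\<Sum>l\<in>UNIV. real (y l)) \<Longrightarrow> N1 \<le> n \<Longrightarrow>
      posterior_mean \<rho> y k \<le> (1 + \<eta>) * ((real (y k) + a) / n)"
    and mean: "\<beta> * real n \<le> (\<Sum>i=1..n. b i)" "(\<Sum>i=1..n. b i) \<le> (1 - \<beta>) * real n"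
    and n: "N1 \<le> \<beta> / 2 * real n" "1 \<le> n"
    and pq: "c * q $ k \<le> p $ k" "0 < p $ k" and a: "a \<le> \<eta> * real n * p $ k / c"
  shows "1 - (4 / \<beta>\<^sup>2 + (1 + c) / \<eta>\<^sup>2) / (real n * p $ k) \<le>
    \<P>(\<omega> in M. p_hat \<pi> n (obs n \<omega>) k \<ge> c * (1 - \<delta>) * q_hat \<rho> n (obs n \<omega>) k)"
proof -
  let ?u = "p $ k" and ?v = "q $ k" and ?n = "real n"
  let ?s = "\<Sum>i=1..n. b i"
  define B R Y Z where "B \<omega> = real (die_count Blue n (obs n \<omega>))"
    and "R \<omega> = real (die_count Red n (obs n \<omega>))"
    and "Y \<omega> = real (side_count Blue n (obs n \<omega>) k)"
    and "Z \<omega> = real (side_count Red n (obs n \<omega>) k)" for \<omega>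
  define E1 where "E1 = {\<omega>\<in>space M. \<beta> / 2 * ?n \<le> \<bar>B \<omega> - ?s\<bar>}"
  define E2 where "E2 = {\<omega>\<in>space M. \<eta> * ?n * ?u \<le> \<bar>Y \<omega> - ?u * B \<omega>\<bar>}"
  \<comment> \<open>The threshold is measured by \<open>p $ k / c\<close>, not by
    \<open>q $ k\<close>, which may be 0 or far smaller.\<close>
  define E3 where "E3 = {\<omega>\<in>space M. \<eta> * ?n * ?u / c \<le> \<bar>Z \<omega> - ?v * R \<omega>\<bar>}"
  let ?G = "{\<omega>\<in>space M. p_hat \<pi> n (obs n \<omega>) k \<ge> c * (1 - \<delta>) * q_hat \<rho> n (obs n \<omega>) k}"
  have \<eta>0: "0 < \<eta>" using assms(4,6) by (simp add: \<eta>)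
  have n0: "0 < ?n" using n(2) by simp
  have v: "0 \<le> ?v" and u1: "?u \<le> 1" using p q by (simp_all add: prob_simplex_nth)
  have [measurable]: "B \<in> borel_measurable M" "R \<in> borel_measurable M"
      "Y \<in> borel_measurable M" "Z \<in> borel_measurable M"
    unfolding B_def R_def Y_def Z_def by (rule borel_measurable_obs)+
  have [measurable]: "E1 \<in> sets M" "E2 \<in> sets M" "E3 \<in> sets M"
    unfolding E1_def E2_def E3_def by measurable
  have "(\<lambda>\<omega>. p_hat \<pi> n (obs n \<omega>) k) \<in> borel_measurable M" "(\<lambda>\<omega>. q_hat \<rho> n (obs n \<omega>) k) \<in> borel_measurable M"
    by (rule borel_measurable_obs)+
  then have [measurable]: "?G \<in> sets M" by measurable
  have "prob E1 \<le> ?n / (\<beta> / 2 * ?n)\<^sup>2"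
    unfolding E1_def B_def using assms(6) n0 by (intro blue_count_tail) auto
  also have "\<dots> = 4 / \<beta>\<^sup>2 / ?n"
    using n0 \<open>0 < \<beta>\<close> by (simp add: power2_eq_square field_simps)
  \<comment> \<open>Weakened by \<open>p $ k \<le> 1\<close> to match the denominator of the other
    two events.\<close>
  also have "\<dots> \<le> 4 / \<beta>\<^sup>2 / (?n * ?u)"
    using n0 u1 pq(2) \<open>0 < \<beta>\<close> by (intro divide_left_mono) (auto intro: mult_left_le)
  finally have E1: "prob E1 \<le> 4 / \<beta>\<^sup>2 / (?n * ?u)" .
  have "prob E2 \<le> ?n * ?u / (\<eta> * ?n * ?u)\<^sup>2"
    unfolding E2_def B_def Y_def
    using side_count_tail[where t = "\<eta> * ?n * ?u" and d = Blue and k = k and n = n] \<eta>0 n0 pq(2) by simp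
  also have "\<dots> = 1 / \<eta>\<^sup>2 / (?n * ?u)"
    using n0 \<eta>0 pq(2) by (simp add: power2_eq_square field_simps)
  finally have E2: "prob E2 \<le> 1 / \<eta>\<^sup>2 / (?n * ?u)" .
  have "prob E3 \<le> ?n * ?v / (\<eta> * ?n * ?u / c)\<^sup>2"
    unfolding E3_def R_def Z_def
    using side_count_tail[where t = "\<eta> * ?n * ?u / c" and d = Red and k = k and n = n] \<eta>0 n0 pq(2) v \<open>0 < c\<close> by simp
  also have "\<dots> \<le> ?n * (?u / c) / (\<eta> * ?n * ?u / c)\<^sup>2"
    using pq n0 \<open>0 < c\<close> by (intro divide_right_mono mult_left_mono) (auto simp: field_simps)
  also have "\<dots> = c / \<eta>\<^sup>2 / (?n * ?u)"
    using n0 \<eta>0 pq(2) \<open>0 < c\<close> by (simp add: power2_eq_square field_simps)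
  finally have E3: "prob E3 \<le> c / \<eta>\<^sup>2 / (?n * ?u)" .
  have "prob (E1 \<union> E2 \<union> E3) \<le> prob E1 + prob E2 + prob E3"
    using measure_Un_le[of "E1 \<union> E2" M E3] measure_Un_le[of E1 M E2] by simp
  also have "\<dots> \<le> (4 / \<beta>\<^sup>2 + (1 + c) / \<eta>\<^sup>2) / (?n * ?u)"
    using E1 E2 E3 by (simp add: add_divide_distrib)
  finally have "prob (E1 \<union> E2 \<union> E3) \<le> (4 / \<beta>\<^sup>2 + (1 + c) / \<eta>\<^sup>2) / (?n * ?u)" .
  moreover have "prob (space M - (E1 \<union> E2 \<union> E3)) = 1 - prob (E1 \<union> E2 \<union> E3)"
    by (rule prob_compl) measurable
  moreover have "prob (space M - (E1 \<union> E2 \<union> E3)) \<le> prob ?G"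
  proof (rule finite_measure_mono)
    show "space M - (E1 \<union> E2 \<union> E3) \<subseteq> ?G"
    proof
      fix \<omega> assume \<omega>: "\<omega> \<in> space M - (E1 \<union> E2 \<union> E3)"
      then have 1: "\<bar>B \<omega> - ?s\<bar> < \<beta> / 2 * ?n" and 2: "\<bar>Y \<omega> - ?u * B \<omega>\<bar> \<le> \<eta> * ?n * ?u"
        and 3: "\<bar>Z \<omega> - ?v * R \<omega>\<bar> \<le> \<eta> * ?n * ?u / c"
        by (auto simp: E1_def E2_def E3_def)
      have "B \<omega> + R \<omega> = ?n"
        using die_count_add[of n "obs n \<omega>"] by (simp add: B_def R_def flip: of_nat_add)
      \<comment> \<open>The mean blue count is at least \<open>\<beta> * n\<close> away from both 0
        and \<open>n\<close>, and a deviation below half of that leaves half for each die.\<close>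
      then have B: "\<beta> / 2 * ?n \<le> B \<omega>" and R: "\<beta> / 2 * ?n \<le> R \<omega>"
        using 1 mean unfolding left_diff_distrib by linarith+
      have sums: "B \<omega> = (\<Sum>l\<in>UNIV. real (side_count Blue n (obs n \<omega>) l))"
          "R \<omega> = (\<Sum>l\<in>UNIV. real (side_count Red n (obs n \<omega>) l))"
        by (simp_all add: B_def R_def flip: of_nat_sum sum_side_count)
      have "c * (1 - \<delta>) * q_hat \<rho> n (obs n \<omega>) k \<le> c * (1 - \<delta>) * ((1 + \<eta>) * ((Z \<omega> + a) / R \<omega>))"
        unfolding q_hat_def Z_def using upper[OF sums(2), of k] R n(1) assms(3-5)
        by (intro mult_left_mono) auto
      also have "\<dots> \<le> (1 - \<eta>) * (Y \<omega> / B \<omega>)"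
        by (rule ratio_inequality[OF assms(3-7) \<eta> n0 B R pq(2,1) 2 3 a])
      also have "\<dots> \<le> p_hat \<pi> n (obs n \<omega>) k"
        unfolding p_hat_def Y_def using lower[OF sums(1), of k] B n(1) by simp
      finally show "\<omega> \<in> ?G" using \<omega> by simp
    qed
  qed measurable
  ultimately show ?thesis by linarith
qed

section \<open>Choice of a threshold uniform in the parameter\<close>

theorem corollary1:
  fixes \<pi> \<rho> :: "real ^ 'k::finite \<Rightarrow> real"
    and P :: "(real ^ 'k) \<times> (real ^ 'k) \<Rightarrow> 'w measure"
    and b :: "nat \<Rightarrow> real"
    and die :: "nat \<Rightarrow> 'w \<Rightarrow> die"
    and side :: "nat \<Rightarrow> 'w \<Rightarrow> 'k"
    and k :: 'k
    and c \<epsilon> \<delta> :: real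
  assumes "CARD('k) \<ge> 2"
    and "prior_density \<pi>" and "condition_P \<pi>"
    and "prior_density \<rho>" and "condition_P \<rho>"
    and "0 < c" and "0 < \<epsilon>" and "\<epsilon> < 1" and "0 < \<delta>" and "\<delta> < 1"
    and "\<And>p q. p \<in> prob_simplex \<Longrightarrow> q \<in> prob_simplex \<Longrightarrow> dice_process (P (p, q)) b p q die side"
    and "\<And>\<theta>. \<theta> \<in> prob_simplex \<times> prob_simplex \<Longrightarrow>
           liminf (\<lambda>n. ereal ((\<integral>\<omega>. real (blue_count die n \<omega>) \<partial>P \<theta>) / real n)) > 0"
    and "\<And>\<theta>. \<theta> \<in> prob_simplex \<times> prob_simplex \<Longrightarrow>
           limsup (\<lambda>n. ereal ((\<integral>\<omega>. real (blue_count die n \<omega>) \<partial>P \<theta>) / real n)) < 1"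
  shows "\<exists>N::nat. N \<ge> 1 \<and>
    (\<forall>p\<in>prob_simplex. \<forall>q\<in>prob_simplex. \<forall>n::nat.
       p $ k \<ge> c * q $ k \<longrightarrow> n \<ge> 1 \<longrightarrow> real n * p $ k \<ge> real N \<longrightarrow>
       \<P>(\<omega> in P (p, q).
          p_hat \<pi> n (observation die side n \<omega>) k
            \<ge> c * (1 - \<delta>) * q_hat \<rho> n (observation die side n \<omega>) k) \<ge> 1 - \<epsilon>)"
proof -
  obtain a1 where a1: "0 < a1" "\<And>\<kappa>. 0 < \<kappa> \<Longrightarrow> \<kappa> < 1 \<Longrightarrow>
    \<exists>N>0. \<forall>y k n. n = (\<Sum>l\<in>UNIV. real (y l)) \<longrightarrow> N \<le> n \<longrightarrow>
      (1 - \<kappa>) * (real (y k) / n) \<le> posterior_mean \<pi> y k \<and>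
      posterior_mean \<pi> y k \<le> (1 + \<kappa>) * ((real (y k) + a1) / n)"
    by (rule posterior_mean_bounds[OF assms(1-3)]) (rule that)
  obtain a where a: "0 < a" "\<And>\<kappa>. 0 < \<kappa> \<Longrightarrow> \<kappa> < 1 \<Longrightarrow>
    \<exists>N>0. \<forall>y k n. n = (\<Sum>l\<in>UNIV. real (y l)) \<longrightarrow> N \<le> n \<longrightarrow>
      (1 - \<kappa>) * (real (y k) / n) \<le> posterior_mean \<rho> y k \<and>
      posterior_mean \<rho> y k \<le> (1 + \<kappa>) * ((real (y k) + a) / n)"
    by (rule posterior_mean_bounds[OF assms(1,4,5)]) (rule that)
  \<comment> \<open>The mean blue count is the same for all parameters, so the two limit conditions
    at a single point, the barycentre \<open>p0\<close> for both dice, give \<beta> and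
    \<open>n0\<close> valid for every parameter.\<close>
  obtain \<beta> n0 where \<beta>: "0 < \<beta>" "\<beta> \<le> 1" and mean: "\<And>n. n0 \<le> n \<Longrightarrow> 1 \<le> n \<Longrightarrow>
      \<beta> * real n \<le> (\<Sum>i=1..n. b i) \<and> (\<Sum>i=1..n. b i) \<le> (1 - \<beta>) * real n"
  proof -
    define p0 :: "real ^ 'k" where "p0 = dirichlet_mean 1"
    have p0: "p0 \<in> prob_simplex"
      unfolding p0_def using dirichlet_mean_in_interior simplex_interior_subset by force
    interpret dice_process "P (p0, p0)" b p0 p0 die side
      by (rule assms(11)[OF p0 p0])
    let ?f = "\<lambda>n. (\<Sum>i=1..n. b i) / real n"
    have "0 < liminf (\<lambda>n. ereal (?f n))" "limsup (\<lambda>n. ereal (?f n)) < 1"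
      using assms(12)[of "(p0, p0)"] assms(13)[of "(p0, p0)"] p0 by (simp_all add: expectation_blue_count)
    from ereal_dense2[OF this(1)] ereal_dense2[OF this(2)]
    obtain x y where x: "0 < ereal x" "ereal x < liminf (\<lambda>n. ereal (?f n))"
      and y: "limsup (\<lambda>n. ereal (?f n)) < ereal y" "ereal y < 1"
      by auto
    have "eventually (\<lambda>n. x < ?f n) sequentially" "eventually (\<lambda>n. ?f n < y) sequentially"
      using less_LiminfD[OF x(2)] Limsup_lessD[OF y(1)] by simp_all
    then have "eventually (\<lambda>n. x < ?f n \<and> ?f n < y) sequentially"
      by (rule eventually_conj)
    then obtain n0 where n0: "\<And>n. n0 \<le> n \<Longrightarrow> x < ?f n \<and> ?f n < y"
      by (auto simp: eventually_sequentially)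
    \<comment> \<open>\<open>x\<close> separates the mean frequency from 0 and \<open>1 - y\<close>
      separates it from 1.\<close>
    define \<beta> where "\<beta> = min (min x (1 - y)) 1"
    have "y < 1" using y(2) by simp
    then have "0 < \<beta>" "\<beta> \<le> 1" using x(1) by (auto simp: \<beta>_def)
    moreover have "\<beta> * real n \<le> (\<Sum>i=1..n. b i) \<and> (\<Sum>i=1..n. b i) \<le> (1 - \<beta>) * real n"
      if "n0 \<le> n" "1 \<le> n" for n
    proof -
      have "\<beta> \<le> ?f n" "?f n \<le> 1 - \<beta>" using n0[OF that(1)] by (auto simp: \<beta>_def)
      then show ?thesis using that(2) by (simp add: field_simps)
    qed
    ultimately show ?thesis by (rule that)
  qed
  define \<eta> where "\<eta> = \<beta> * \<delta> / 20"
  have \<eta>: "0 < \<eta>" "\<eta> < 1"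
  proof -
    show "0 < \<eta>" using \<beta> \<open>0 < \<delta>\<close> by (simp add: \<eta>_def)
    have "\<beta> * \<delta> \<le> 1 * 1" using \<beta> \<open>0 < \<delta>\<close> \<open>\<delta> < 1\<close> by (intro mult_mono) auto
    then show "\<eta> < 1" by (simp add: \<eta>_def)
  qed
  obtain Np where Np: "\<And>y k n. n = (\<Sum>l\<in>UNIV. real (y l)) \<Longrightarrow> Np \<le> n \<Longrightarrow>
      (1 - \<eta>) * (real (y k) / n) \<le> posterior_mean \<pi> y k"
    using a1(2)[OF \<eta>] by blast
  obtain Nq where Nq: "\<And>y k n. n = (\<Sum>l\<in>UNIV. real (y l)) \<Longrightarrow> Nq \<le> n \<Longrightarrow>
      posterior_mean \<rho> y k \<le> (1 + \<eta>) * ((real (y k) + a) / n)"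
    using a(2)[OF \<eta>] by blast
  define N1 where "N1 = max Np Nq"
  define C where "C = 4 / \<beta>\<^sup>2 + (1 + c) / \<eta>\<^sup>2"
  \<comment> \<open>Since \<open>n \<ge> n * p $ k \<ge> N\<close>, the entries with
    \<open>n0\<close> and \<open>N1\<close> make \<open>n\<close> large enough for the mean bounds
    and the estimator bounds. The entry \<open>a * c / \<eta>\<close> makes the prior mass
    negligible against \<open>n * p $ k\<close>, and \<open>C / \<epsilon>\<close> bounds the
    failure probability by \<epsilon>.\<close>
  obtain N :: nat where N: "Max {1, real n0, 2 * N1 / \<beta>, a * c / \<eta>, C / \<epsilon>} \<le> real N"
    using real_arch_simple by blast
  then have N': "1 \<le> N" "n0 \<le> N" "2 * N1 / \<beta> \<le> real N" "a * c / \<eta> \<le> real N" "C / \<epsilon> \<le> real N"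
    by simp_all
  show ?thesis
  proof (intro exI[of _ N] conjI ballI allI impI)
    fix p q :: "real ^ 'k" and n :: nat
    assume p: "p \<in> prob_simplex" and q: "q \<in> prob_simplex" and pq: "c * q $ k \<le> p $ k"
      and n: "1 \<le> n" and nN: "real N \<le> real n * p $ k"
    interpret dice_process "P (p, q)" b p q die side by (rule assms(11)[OF p q])
    have "real n * p $ k \<le> real n"
      using prob_simplex_nth(2)[OF p, of k] by (simp add: mult_left_le)
    with nN have "N \<le> n" by linarith
    have npk: "0 < real n * p $ k" using nN N'(1) by linarith
    then have pk: "0 < p $ k" using n by (simp add: zero_less_mult_iff)
    have "C / \<epsilon> \<le> real n * p $ k" using N'(5) nN by linarith
    then have "C / (real n * p $ k) \<le> \<epsilon>"
      using npk \<open>0 < \<epsilon>\<close> by (simp add: field_simps)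
    moreover have "1 - C / (real n * p $ k) \<le>
        \<P>(\<omega> in P (p, q). p_hat \<pi> n (observation die side n \<omega>) k
          \<ge> c * (1 - \<delta>) * q_hat \<rho> n (observation die side n \<omega>) k)"
      unfolding C_def
    proof (rule estimator_ratio_probability[where a = a and ?N1.0 = N1])
      show "\<eta> = \<beta> * \<delta> / 20" by (rule \<eta>_def)
      show "\<beta> * real n \<le> (\<Sum>i=1..n. b i)" "(\<Sum>i=1..n. b i) \<le> (1 - \<beta>) * real n"
        using mean[of n] \<open>N \<le> n\<close> N'(2) n by auto
      have "2 * N1 / \<beta> \<le> real n" using N'(3) \<open>N \<le> n\<close> by linarith
      then show "N1 \<le> \<beta> / 2 * real n" using \<beta>(1) by (simp add: field_simps)
      have "a * c / \<eta> \<le> real n * p $ k" using N'(4) nN by linarith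
      then show "a \<le> \<eta> * real n * p $ k / c"
        using \<eta>(1) \<open>0 < c\<close> by (simp add: field_simps)
    qed (use assms(6,9,10) \<beta> a(1) p q pq pk n Np Nq in \<open>simp_all add: N1_def\<close>)
    ultimately show "1 - \<epsilon> \<le> \<P>(\<omega> in P (p, q). p_hat \<pi> n (observation die side n \<omega>) k
          \<ge> c * (1 - \<delta>) * q_hat \<rho> n (observation die side n \<omega>) k)"
      by linarith
  qed (rule N'(1))
qed

end
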